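(* Suppose that the following four assumptions, spelled out in the context, hold: strong convexity, general smoothness, sufficient connectivity, and mutual independence. Let $\tilde x^*$ be the optimal solution of $\min_{\tilde x\in\mathbb R^n}\sum_{i\in\mathcal R} f_i(\tilde x)+r_i(\tilde x)$, let $x^*=1_{|\mathcal R|}\otimes\tilde x^*$, and let the penalty parameter satisfy, for given $\partial r_i^*\in\partial r_i(\tilde x^* )$, $i\in\mathcal R$, $$\phi\ \ge\ \frac{|\mathcal R|^{3/2}\sqrt{|\bar{\mathcal E}_{\mathcal R}|}}{\lambda_{\min}(\Omega)}\ \max_{i\in\mathcal R}\big\|\nabla f_i(\tilde x^* )+\partial r_i^*\big\|_\infty .$$ Let $c$ be a constant with $0<c<\lambda_{\min}(Q)/(2\lambda_{\max}(M))$, and let RED-SEGA be run with a constant step-size $\alpha_k=\alpha$ satisfying $$0<\alpha\le\min\left\{\frac{c\,\lambda_{\min}(M)}{\lambda_{\max}\big(\gamma cW+4(\Phi-W)\big)},\ \frac{\lambda_{\min}(Q/2-cM)}{4\lambda_{\max}(\Phi)}\right\}.$$ Then the sequence $\{x_k\}_{k\ge0}$ generated by RED-SEGA satisfies, for all $k\ge 0$, $$\mathbb E\big[U_k^W\big]\le(1-\gamma\alpha)^kU_0^W+\frac{\Gamma_1\alpha+\Gamma_2}{\gamma}\big(1-(1-\gamma\alpha)^k\big),$$ where $$U_k^W=\|x_k-x^*\|_W^2+c\alpha\|\Delta_k^\psi\|_W^2,\qquad \gamma=\mu/2,$$ $$\Gamma_1=4n\phi^2\sum_{i\in\mathcal R}\big(4|\mathcal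 R_i|^2+|\mathcal B_i|^2\big)\lambda_{\max}(W_i),\qquad \Gamma_2=\frac{16n\phi^2}{\mu}\sum_{i\in\mathcal R}\big(4|\mathcal R_i|^2+|\mathcal B_i|^2\big)\lambda_{\max}(W_i).$$ In particular, $\{x_k\}$ converges linearly, at rate $(1-\gamma\alpha)^k$ in the sense of the bound $\mathbb E[U_k^W]\le(1-\gamma\alpha)^kU_0^W+\frac{\Gamma_1\alpha+\Gamma_2}{\gamma}\big(1-(1-\gamma\alpha)^k\big)$, to an error ball centered at $x^*$ whose size (bound on $\limsup_k\mathbb E\|x_k-x^*\|_W^2$) is proportional to $(\Gamma_1\alpha+\Gamma_2)/\gamma$.
   Context: Agents. A finite set of agents $\mathcal V$ is partitioned into reliable agents $\mathcal R$ and Byzantine agents $\mathcal B$. For each $i\in\mathcal R$: $f_i:\mathbb R^n\to\mathbb R$ is differentiable with gradient $\nabla f_i$; $r_i:\mathbb R^n\to\mathbb R\cup\{+\infty\}$ is closed, proper and convex with subdifferential $\partial r_i$; $W_i\in\mathbb R^{n\times n}$ is symmetric positive definite. Notation: $\langle x,y\rangle_W=x^\top Wy$, $\|x\|_A^2=x^\top Ax$; $\|\cdot\|_a$ is the $\ell_a$-norm on $\mathbb R^n$ for a fixed $a\ge1$; $\mathrm{col}\{\cdot\}$ stacks vectors and $\mathbf{diag}\{\cdot\}$ forms block-diagonal matrices; $1_m$ is the all-ones vector; $\lambda_{\min},\lambda_{\max}$ denote smallest and largest eigenvalues of symmetric matrices; $\dagger$ is the Moore-Penrose pseudo-inverse.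 Strong convexity. For every $i\in\mathcal R$ there is $\mu_i>0$ such that for all $\tilde x,\tilde y$: $f_i(\tilde x)\ge f_i(\tilde y)+\langle\nabla f_i(\tilde y),\tilde x-\tilde y\rangle_{W_i}+\frac{\mu_i}2\|\tilde x-\tilde y\|_{W_i}^2$. Put $\mu=\min_{i\in\mathcal R}\mu_i$. General smoothness. For every $i\in\mathcal R$ there is a positive-definite matrix $Q_i$ such that for all $\tilde x,\tilde y$: $f_i(\tilde x)-f_i(\tilde y)-\langle\nabla f_i(\tilde y),\tilde x-\tilde y\rangle_{W_i}\ge\frac12\|\nabla f_i(\tilde x)-\nabla f_i(\tilde y)\|_{Q_i}^2$. Network. At iteration $k\ge0$ the agents communicate over an undirected graph $\mathcal G_k=(\mathcal V,\mathcal E_k)$. $\mathcal N_{i,k}=\mathcal R_{i,k}\cup\mathcal B_{i,k}$ is the set of neighbours of $i$ at iteration $k$ (excluding $i$), split into reliable and Byzantine neighbours; $\mathcal R_i=\bigcup_k\mathcal R_{i,k}$ and $\mathcal B_i=\bigcup_k\mathcal B_{i,k}$. For a candidate edge $(i,j)\in\bigcup_k\mathcal E_k$, $\bar\zeta_{(i,j),k}=1$ if $(i,j)\in\mathcal E_k$ and $0$ otherwise, and $\zeta_k$ is the vector of these indicators. At any iteration $k$ the entries of $\zeta_k$ for different edges are independent; the $\zeta_k$ need not be independent across $k$. For $i,j\in\mathcal R$, $i<j$, $\omega_{(i,j)}=\liminf_{T\to\infty}\frac1T\sum_{l=0}^{T-1}\bar\zeta_{(i,j),l}$; $\bar{\mathcal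 E}_{\mathcal R}=\{(i,j):i,j\in\mathcal R,i<j,\omega_{(i,j)}>0\}$ and $\bar{\mathcal G}_{\mathcal R}=(\mathcal R,\bar{\mathcal E}_{\mathcal R})$ is the average network. $\Omega$ is the weighted incidence matrix with rows indexed by $\mathcal R$, columns by $\bar{\mathcal E}_{\mathcal R}$: for $e=(i,j)$, $i<j$, $\omega_e=\omega_{(i,j)}$, the $(i,e)$ entry is $\omega_e$, the $(j,e)$ entry is $-\omega_e$, other entries of column $e$ are $0$. $\lambda_{\min}(\Omega)$ denotes the smallest nonzero singular value of $\Omega$. Sufficient connectivity. As $K\to\infty$, the empirical distribution of $\{\zeta_k\}_{k=0,\dots,K}$ converges to the distribution of some random vector $\bar\zeta$ whose entries for edges between reliable agents satisfy $\mathbb E[\bar\zeta_{(i,j)}]=\omega_{(i,j)}$; furthermore $\bar{\mathcal G}_{\mathcal R}$ is (bidirectionally) connected. Gradient sketching. Each $i\in\mathcal R$ has a fixed distribution $\mathcal D_i$ over sketching matrices in $\mathbb R^{n\times p}$, $p\ge1$, from which $S_{i,k}$, $k=0,1,\dots$, are sampled i.i.d. Mutual independence: the distributions $\mathcal D_i$, $i\in\mathcal R$, are mutually independent across reliable agents. Put $M_{i,k}=S_{i,k}\big(S_{i,k}^\top W_i^{-1}S_{i,k}\big)^\dagger S_{i,k}^\top$, and let $\theta_{i,k}=\theta(S_{i,k})>0$ be such that $\mathbb E_{\mathcal D_i}[\theta_{i,k}M_{i,k}]=W_i$. Define $M_i=\mathbb E_{\mathcal D_i}[M_{i,k}]$,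 $\Phi_i=\mathbb E_{\mathcal D_i}[\theta_{i,k}^2M_{i,k}]$ (independent of $k$), and $M=\mathbf{diag}\{M_i\}_{i\in\mathcal R}$, $\Phi=\mathbf{diag}\{\Phi_i\}_{i\in\mathcal R}$, $Q=\mathbf{diag}\{Q_i\}_{i\in\mathcal R}$, $W=\mathbf{diag}\{W_i\}_{i\in\mathcal R}$. RED-SEGA. With arbitrary $x_{i,0},h_{i,0}\in\mathbb R^n$, for $k=0,1,\dots$ every $i\in\mathcal R$ performs $$h_{i,k+1}=h_{i,k}+W_i^{-1}M_{i,k}\big(\nabla f_i(x_{i,k})-h_{i,k}\big),$$ $$g_{i,k}=h_{i,k}+\theta_{i,k}W_i^{-1}M_{i,k}\big(\nabla f_i(x_{i,k})-h_{i,k}\big),$$ $$\bar x_{i,k}=x_{i,k}-\alpha_k g_{i,k}-\alpha_k\phi\sum_{j\in\mathcal R_{i,k}\cup\mathcal B_{i,k}}\partial\|x_{i,k}-x_{ij,k}\|_a,$$ $$x_{i,k+1}=\arg\min_{\tilde y}\Big\{r_i(\tilde y)+\frac1{2\alpha_k}\|\tilde y-\bar x_{i,k}\|_{W_i}^2\Big\},$$ where $\partial\|x_{i,k}-x_{ij,k}\|_a$ denotes a subgradient of $\|\cdot\|_a$ at $x_{i,k}-x_{ij,k}$, $x_{ij,k}=x_{j,k}$ if $j\in\mathcal R_{i,k}$, and $x_{ij,k}=z_{ij,k}$ is an arbitrary vector of $\mathbb R^n$ (chosen by the Byzantine agent $j$) if $j\in\mathcal B_{i,k}$. Put $x_k=\mathrm{col}\{x_{i,k}\}_{i\in\mathcal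 R}$, $\Delta^\psi_{i,k}=h_{i,k}-\nabla f_i(\tilde x^* )$, $\Delta_k^\psi=\mathrm{col}\{\Delta^\psi_{i,k}\}_{i\in\mathcal R}$. $\mathbb E$ is the expectation over the random sketches. *)

theory Defs
  imports "HOL-Probability.Probability"
begin

definition wip :: "real^'n^'n \<Rightarrow> real^'n \<Rightarrow> real^'n \<Rightarrow> real" where
  "wip A x y = x \<bullet> (A *v y)"

definition wnorm2 :: "real^'n^'n \<Rightarrow> real^'n \<Rightarrow> real" where
  "wnorm2 A x = wip A x x"

definition pos_def :: "real^'n^'n \<Rightarrow> bool" where
  "pos_def A \<longleftrightarrow> transpose A = A \<and> (\<forall>x. x \<noteq> 0 \<longrightarrow> 0 < wnorm2 A x)"

definition eigenvalues :: "real^'m^'m \<Rightarrow> real set" where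
  "eigenvalues A = {l. \<exists>v. v \<noteq> 0 \<and> A *v v = l *\<^sub>R v}"

definition lambda_min :: "real^'m^'m \<Rightarrow> real" where
  "lambda_min A = Min (eigenvalues A)"

definition lambda_max :: "real^'m^'m \<Rightarrow> real" where
  "lambda_max A = Max (eigenvalues A)"

definition min_nonzero_singular_value :: "real^'m^'k \<Rightarrow> real" where
  "min_nonzero_singular_value A = Min {s. 0 < s \<and> s\<^sup>2 \<in> eigenvalues (transpose A ** A)}"

definition pseudo_inverse :: "real^'n^'m \<Rightarrow> real^'m^'n" where
  "pseudo_inverse A = (THE X. A ** X ** A = A \<and> X ** A ** X = X \<and>
     transpose (A ** X) = A ** X \<and> transpose (X ** A) = X ** A)"

definition col :: "('r::finite \<Rightarrow> real^'n) \<Rightarrow> real^('r \<times> 'n)" where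
  "col X = (\<chi> p. X (fst p) $ snd p)"

definition block_diag :: "('r::finite \<Rightarrow> real^'n^'n) \<Rightarrow> real^('r \<times> 'n)^('r \<times> 'n)" where
  "block_diag A = (\<chi> p q. if fst p = fst q then A (fst p) $ snd p $ snd q else 0)"

definition closed_proper_convex :: "(real^'n \<Rightarrow> ereal) \<Rightarrow> bool" where
  "closed_proper_convex r \<longleftrightarrow> (\<forall>x. r x \<noteq> -\<infinity>) \<and> (\<exists>x. r x \<noteq> \<infinity>) \<and>
     closed {(x, t). r x \<le> ereal t} \<and> convex {(x, t). r x \<le> ereal t}"

text \<open>
  Subdifferential with respect to the inner product of \<open>W\<close>; \<open>W = mat 1\<close> is the Euclidean one. For
  the regularizers it is taken in the inner product of \<open>W\<^sub>i\<close>, in which the gradients and the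
  proximal step live (so that gradient and subgradient can be added); for the penalty norm it is
  the Euclidean one.
\<close>

definition subdiff :: "real^'n^'n \<Rightarrow> (real^'n \<Rightarrow> ereal) \<Rightarrow> real^'n \<Rightarrow> (real^'n) set" where
  "subdiff W r x = {s. \<bar>r x\<bar> \<noteq> \<infinity> \<and> (\<forall>y. r y \<ge> r x + ereal (wip W s (y - x)))}"

definition lp_norm :: "real \<Rightarrow> real^'n \<Rightarrow> real" where
  "lp_norm a x = (\<Sum>j\<in>UNIV. \<bar>x $ j\<bar> powr a) powr (1 / a)"

definition is_W_gradient :: "real^'n^'n \<Rightarrow> (real^'n \<Rightarrow> real) \<Rightarrow> (real^'n \<Rightarrow> real^'n) \<Rightarrow> bool" where
  "is_W_gradient W f G \<longleftrightarrow> (\<forall>x. (f has_derivative (\<lambda>v. wip W (G x) v)) (at x))"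

definition strongly_convex_wrt ::
  "real^'n^'n \<Rightarrow> real \<Rightarrow> (real^'n \<Rightarrow> real) \<Rightarrow> (real^'n \<Rightarrow> real^'n) \<Rightarrow> bool" where
  "strongly_convex_wrt W m f G \<longleftrightarrow>
     (\<forall>x y. f x \<ge> f y + wip W (G y) (x - y) + m / 2 * wnorm2 W (x - y))"

definition smooth_wrt ::
  "real^'n^'n \<Rightarrow> real^'n^'n \<Rightarrow> (real^'n \<Rightarrow> real) \<Rightarrow> (real^'n \<Rightarrow> real^'n) \<Rightarrow> bool" where
  "smooth_wrt W Q f G \<longleftrightarrow>
     (\<forall>x y. f x - f y - wip W (G y) (x - y) \<ge> 1 / 2 * wnorm2 Q (G x - G y))"

text \<open>
  Why gradients are taken in the \<open>W\<close>-inner product: for a differentiable function, the strong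
  convexity inequality, in which the linear term is \<open>wip W (G y) (x - y)\<close>, already forces
  \<open>G\<close> to represent the derivative in that inner product.
\<close>

lemma strongly_convex_wrt_imp_is_W_gradient:
  assumes "pos_def W" and "0 \<le> m" and sc: "strongly_convex_wrt W m f G"
    and diff: "\<And>x. f differentiable (at x)"
  shows "is_W_gradient W f G"
  unfolding is_W_gradient_def
proof
  fix x
  obtain f' where f': "(f has_derivative f') (at x)"
    using diff[of x] by (auto simp: differentiable_def)
  have "0 \<le> wnorm2 W v" for v
  proof (cases "v = 0")
    case True
    then show ?thesis by (simp add: wnorm2_def wip_def)
  next
    case False
    then show ?thesis using assms(1) by (simp add: pos_def_def less_imp_le)
  qed
  then have "0 \<le> m / 2 * wnorm2 W v" for v
    using \<open>0 \<le> m\<close> by simp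
  then have le: "f x + wip W (G x) (y - x) \<le> f y" for y
    using sc unfolding strongly_convex_wrt_def by (meson add_increasing2 order_trans le_add_same_cancel1)
  have lin: "bounded_linear (wip W (G x))"
    unfolding wip_def
    by (intro bounded_linear_compose[OF bounded_linear_inner_right] matrix_vector_mul_bounded_linear)
  have "((\<lambda>y. f y - wip W (G x) (y - x)) has_derivative (\<lambda>v. f' v - wip W (G x) (v - 0))) (at x)"
    by (intro has_derivative_diff f' bounded_linear.has_derivative[OF lin]
        has_derivative_ident has_derivative_const)
  moreover have "wip W (G x) (x - x) = 0"
    by (simp add: wip_def)
  then have "\<forall>\<^sub>F y in at x. f x - wip W (G x) (x - x) \<le> f y - wip W (G x) (y - x)"
    using le by (simp add: le_diff_eq)
  ultimately have "(\<lambda>v. f' v - wip W (G x) (v - 0)) = (\<lambda>v. 0)"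
    by (rule has_derivative_local_min)
  then have "f' v = wip W (G x) v" for v
    by (simp add: fun_eq_iff)
  then have "f' = (\<lambda>v. wip W (G x) v)" ..
  then show "(f has_derivative (\<lambda>v. wip W (G x) v)) (at x)" using f' by simp
qed

text \<open>
  Agents form the disjoint sum \<open>UNIV <+> B\<close>: the reliable agents are the elements of the finite
  type \<open>'r\<close>, the Byzantine agents those of the (possibly empty) finite set \<open>B\<close>. Undirected edges
  are two-element sets of agents, and a communication graph is its edge set.
\<close>

definition agent_pairs :: "'b set \<Rightarrow> ('r + 'b) set set" where
  "agent_pairs B = {{i, j} | i j. i \<in> UNIV <+> B \<and> j \<in> UNIV <+> B \<and> i \<noteq> j}"

definition neighbours :: "('r + 'b) set set \<Rightarrow> 'r \<Rightarrow> ('r + 'b) set" where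
  "neighbours E i = {j. {Inl i, j} \<in> E}"

definition all_reliable_neighbours :: "(nat \<Rightarrow> ('r + 'b) set set) \<Rightarrow> 'r \<Rightarrow> 'r set" where
  "all_reliable_neighbours E i = (\<Union>k. {j. Inl j \<in> neighbours (E k) i})"

definition all_byzantine_neighbours :: "(nat \<Rightarrow> ('r + 'b) set set) \<Rightarrow> 'r \<Rightarrow> 'b set" where
  "all_byzantine_neighbours E i = (\<Union>k. {j. Inr j \<in> neighbours (E k) i})"

definition zeta :: "'e set \<Rightarrow> 'e \<Rightarrow> real" where
  "zeta E e = indicat_real E e"

text \<open>
  The entries of \<open>zeta\<close> are indexed by all pairs of agents; pairs that never become an edge have a
  constant entry 0, which is independent of everything.
\<close>

definition random_network ::
  "'u measure \<Rightarrow> 'b set \<Rightarrow> (nat \<Rightarrow> 'u \<Rightarrow> ('r + 'b) set set) \<Rightarrow> bool" where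
  "random_network N B Net \<longleftrightarrow> prob_space N \<and>
     (\<forall>k. \<forall>u\<in>space N. Net k u \<subseteq> agent_pairs B) \<and>
     (\<forall>k. prob_space.indep_vars N (\<lambda>_. borel) (\<lambda>e u. zeta (Net k u) e) (agent_pairs B))"

definition avg_weight :: "(nat \<Rightarrow> ('r + 'b) set set) \<Rightarrow> 'r \<Rightarrow> 'r \<Rightarrow> real" where
  "avg_weight E i j =
     real_of_ereal (liminf (\<lambda>T. ereal (1 / real T * (\<Sum>l<T. zeta (E l) {Inl i, Inl j}))))"

definition avg_edges :: "(nat \<Rightarrow> ('r::linorder + 'b) set set) \<Rightarrow> ('r \<times> 'r) set" where
  "avg_edges E = {(i, j). i < j \<and> 0 < avg_weight E i j}"

text \<open>
  Columns belonging to pairs outside \<open>avg_edges E\<close> are zero; such padding does not affect the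
  nonzero singular values.
\<close>

definition incidence ::
  "(nat \<Rightarrow> ('r::{finite,linorder} + 'b) set set) \<Rightarrow> real^('r::{finite,linorder} \<times> 'r::{finite,linorder})^'r::{finite,linorder}"
where
  "incidence E = (\<chi> v e. if e \<notin> avg_edges E then 0
     else if v = fst e then avg_weight E (fst e) (snd e)
     else if v = snd e then - avg_weight E (fst e) (snd e)
     else 0)"

text \<open>
  The vectors \<open>zeta (E k)\<close> range over a finite set, so convergence in distribution of the empirical
  measures is convergence of the point masses.
\<close>

definition sufficient_connectivity :: "(nat \<Rightarrow> ('r::linorder + 'b) set set) \<Rightarrow> bool" where
  "sufficient_connectivity E \<longleftrightarrow>
     (\<exists>D :: (('r + 'b) set \<Rightarrow> real) pmf.
        (\<forall>v. (\<lambda>K. pmf (map_pmf (\<lambda>k. zeta (E k)) (pmf_of_set {..K})) v) \<longlonglongrightarrow> pmf D v) \<and>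
        (\<forall>i j. i < j \<longrightarrow> measure_pmf.expectation D (\<lambda>v. v {Inl i, Inl j}) = avg_weight E i j)) \<and>
     (\<forall>i j. (i, j) \<in> (avg_edges E \<union> (avg_edges E)\<inverse>)\<^sup>*)"

definition sketch_mat :: "real^'n^'n \<Rightarrow> real^'p^'n \<Rightarrow> real^'n^'n" where
  "sketch_mat W S = S ** pseudo_inverse (transpose S ** matrix_inv W ** S) ** transpose S"

definition sketch_mean :: "real^'n^'n \<Rightarrow> (real^'p^'n) measure \<Rightarrow> real^'n^'n" where
  "sketch_mean W D = (\<integral>S. sketch_mat W S \<partial>D)"

definition sketch_second ::
  "real^'n^'n \<Rightarrow> (real^'p^'n) measure \<Rightarrow> (real^'p^'n \<Rightarrow> real) \<Rightarrow> real^'n^'n" where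
  "sketch_second W D th = (\<integral>S. (th S)\<^sup>2 *\<^sub>R sketch_mat W S \<partial>D)"

text \<open>The integrability clauses state that the three expectations exist.\<close>

definition sketch_law ::
  "real^'n^'n \<Rightarrow> (real^'p^'n) measure \<Rightarrow> (real^'p^'n \<Rightarrow> real) \<Rightarrow> bool" where
  "sketch_law W D th \<longleftrightarrow> prob_space D \<and> sets D = sets borel \<and> (\<forall>S. 0 < th S) \<and>
     integrable D (sketch_mat W) \<and>
     integrable D (\<lambda>S. th S *\<^sub>R sketch_mat W S) \<and>
     integrable D (\<lambda>S. (th S)\<^sup>2 *\<^sub>R sketch_mat W S) \<and>
     (\<integral>S. th S *\<^sub>R sketch_mat W S \<partial>D) = W"

text \<open>
  \<open>F k\<close> is the information available before the sketches of iteration \<open>k\<close> are drawn. It may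
  be larger than the history of the sketches, e.g. contain the private randomness of Byzantine
  agents. The last clause says that the sketches of iteration \<open>k\<close> are jointly independent of \<open>F k\<close>.
\<close>

definition sketch_sampling ::
  "'w measure \<Rightarrow> (nat \<Rightarrow> 'w measure) \<Rightarrow> ('r::finite \<Rightarrow> (real^'p^'n) measure) \<Rightarrow>
   ('r \<Rightarrow> nat \<Rightarrow> 'w \<Rightarrow> real^'p^'n) \<Rightarrow> bool" where
  "sketch_sampling P F D S \<longleftrightarrow> prob_space P \<and>
     filtration (space P) F \<and> (\<forall>k. subalgebra P (F k)) \<and>
     (\<forall>i k. S i k \<in> borel_measurable (F (Suc k))) \<and>
     (\<forall>i k. distr P borel (S i k) = D i) \<and>
     prob_space.indep_vars P (\<lambda>_. borel) (\<lambda>(i, k). S i k) UNIV \<and>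
     (\<forall>k. prob_space.indep_set P
        (sets (vimage_algebra (space P) (\<lambda>w i. S i k w) (Pi\<^sub>M UNIV (\<lambda>_. borel)))) (sets (F k)))"

text \<open>
  \<open>sg i j k w\<close> is the chosen subgradient of the norm at \<open>x\<^sub>i\<^sub>,\<^sub>k - x\<^sub>i\<^sub>j\<^sub>,\<^sub>k\<close>. The vectors
  \<open>z i j k w\<close> sent by Byzantine agents enter only through these subgradients and are otherwise
  unrestricted. Measurability with respect to \<open>F (Suc k)\<close> is causality: the attack and the choice
  of subgradients at iteration \<open>k\<close> may use everything up to and including the current sketches,
  but not the future ones.
\<close>

definition red_sega ::
  "('r::finite \<Rightarrow> real^'n^'n) \<Rightarrow> ('r \<Rightarrow> real^'n \<Rightarrow> real^'n) \<Rightarrow> ('r \<Rightarrow> real^'n \<Rightarrow> ereal) \<Rightarrow>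
   ('r \<Rightarrow> real^'p^'n \<Rightarrow> real) \<Rightarrow> real \<Rightarrow> real \<Rightarrow> (nat \<Rightarrow> real) \<Rightarrow>
   (nat \<Rightarrow> ('r + 'b) set set) \<Rightarrow> 'w measure \<Rightarrow> (nat \<Rightarrow> 'w measure) \<Rightarrow>
   ('r \<Rightarrow> nat \<Rightarrow> 'w \<Rightarrow> real^'p^'n) \<Rightarrow> ('r \<Rightarrow> 'b \<Rightarrow> nat \<Rightarrow> 'w \<Rightarrow> real^'n) \<Rightarrow>
   ('r \<Rightarrow> 'r + 'b \<Rightarrow> nat \<Rightarrow> 'w \<Rightarrow> real^'n) \<Rightarrow> ('r \<Rightarrow> real^'n) \<Rightarrow> ('r \<Rightarrow> real^'n) \<Rightarrow>
   ('r \<Rightarrow> nat \<Rightarrow> 'w \<Rightarrow> real^'n) \<Rightarrow> ('r \<Rightarrow> nat \<Rightarrow> 'w \<Rightarrow> real^'n) \<Rightarrow> bool" where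
  "red_sega W G r th a ph al E P F S z sg x0 h0 x h \<longleftrightarrow>
     (\<forall>i j k. sg i j k \<in> borel_measurable (F (Suc k))) \<and>
     (\<forall>w\<in>space P. \<forall>i. x i 0 w = x0 i \<and> h i 0 w = h0 i) \<and>
     (\<forall>w\<in>space P. \<forall>i k.
        (let M = sketch_mat (W i) (S i k w);
             d = matrix_inv (W i) *v (M *v (G i (x i k w) - h i k w));
             g = h i k w + th i (S i k w) *\<^sub>R d;
             recv = (\<lambda>j. case j of Inl j' \<Rightarrow> x j' k w | Inr b \<Rightarrow> z i b k w);
             xbar = x i k w - al k *\<^sub>R g - (al k * ph) *\<^sub>R (\<Sum>j\<in>neighbours (E k) i. sg i j k w)
         in (\<forall>j\<in>neighbours (E k) i.
               sg i j k w \<in> subdiff (mat 1) (\<lambda>v. ereal (lp_norm a v)) (x i k w - recv j)) \<and>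
            h i (Suc k) w = h i k w + d \<and>
            is_arg_min (\<lambda>y. r i y + ereal (1 / (2 * al k) * wnorm2 (W i) (y - xbar)))
              (\<lambda>_. True) (x i (Suc k) w)))"

definition sq_error :: "('r::finite \<Rightarrow> real^'n^'n) \<Rightarrow> real^'n \<Rightarrow> ('r \<Rightarrow> real^'n) \<Rightarrow> real" where
  "sq_error W xs X = wnorm2 (block_diag W) (col X - col (\<lambda>_. xs))"

definition lyapunov ::
  "('r::finite \<Rightarrow> real^'n^'n) \<Rightarrow> ('r \<Rightarrow> real^'n \<Rightarrow> real^'n) \<Rightarrow> real \<Rightarrow> real \<Rightarrow> real^'n \<Rightarrow>
   ('r \<Rightarrow> real^'n) \<Rightarrow> ('r \<Rightarrow> real^'n) \<Rightarrow> real" where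
  "lyapunov W G c al xs X H =
     sq_error W xs X + c * al * wnorm2 (block_diag W) (col (\<lambda>i. H i - G i xs))"

definition neighbour_weight ::
  "('r::finite \<Rightarrow> real^'n^'n) \<Rightarrow> (nat \<Rightarrow> ('r + 'b) set set) \<Rightarrow> real" where
  "neighbour_weight W E = (\<Sum>i\<in>UNIV.
     (4 * (real (card (all_reliable_neighbours E i)))\<^sup>2 + (real (card (all_byzantine_neighbours E i)))\<^sup>2)
     * lambda_max (W i))"

end

theory Submission
  imports Defs
begin

text \<open>
  Every subgradient of the penalty has Euclidean norm at most \<open>sqrt n\<close>, and the penalty bound
  makes \<open>G i xs + s\<close> of size at most \<open>ph * sqrt n * card (all_reliable_neighbours E i)\<close> for a suitable
  subgradient \<open>s\<close> of \<open>r i\<close> at \<open>xs\<close>. Hence each agent runs proximal SEGA for its own \<open>f i + r i\<close>, compared with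
  the common point \<open>xs\<close>, up to a perturbation of bounded size, and neither the consensus structure
  nor the honesty of the neighbours matters any further. The perturbation is split off by Young's
  inequality with weight \<open>mu / 2\<close>. In the remaining step the sketches are independent of the past,
  the identity \<open>K W\<inverse> K = K\<close> for the sketched projection \<open>K\<close> makes all second moments quadratic forms in \<open>K\<close>, and the step-size
  conditions are exactly what makes the terms in the gradient difference and in \<open>h i - G i xs\<close> drop out.
\<close>

section \<open>Quadratic forms and extreme eigenvalues\<close>

text \<open>The attack and the chosen subgradients of an iteration may depend on its sketches, so an
  expectation that contains the perturbation cannot be factored. The perturbation is therefore
  bounded outcome by outcome. Young's inequality then leaves a term of order \<open>al\<close>, the
  same order as the contraction, and this is the origin of \<open>Gam2\<close>. Every other term
  pairs a function of the current sketch with vectors known beforehand, and averaging replaces the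
  matrices K, theta K and theta^2 K by M, W and Phi. The rate arises as follows: strong convexity
  decreases the squared distance by the fraction \<open>mu * al\<close>, and Young's inequality
  gives half of it back, hence \<open>gam = mu / 2\<close>. A second obstacle is that the iterates
  are known only through a minimality property, while expectations require measurability and square
  integrability. Both are therefore carried through the same induction as the bound.\<close>

lemma wip_add_left: "wip A (x + y) z = wip A x z + wip A y z"
  and wip_add_right: "wip A x (y + z) = wip A x y + wip A x z"
  and wip_diff_left: "wip A (x - y) z = wip A x z - wip A y z"
  and wip_diff_right: "wip A x (y - z) = wip A x y - wip A x z"
  and wip_scaleR_left: "wip A (t *\<^sub>R x) y = t * wip A x y"
  and wip_scaleR_right: "wip A x (t *\<^sub>R y) = t * wip A x y"
  and wip_minus_left: "wip A (- x) y = - wip A x y"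
  and wip_minus_right: "wip A x (- y) = - wip A x y"
  and wip_zero_left [simp]: "wip A 0 y = 0"
  and wip_zero_right [simp]: "wip A x 0 = 0"
  by (simp_all add: wip_def inner_add_left inner_diff_left matrix_vector_right_distrib
      inner_add_right matrix_vector_mult_diff_distrib inner_diff_right matrix_vector_mult_scaleR
      vec.neg)

lemmas wip_linear = wip_add_left wip_add_right wip_diff_left wip_diff_right wip_scaleR_left
  wip_scaleR_right wip_minus_left wip_minus_right

lemma wip_matrix_add: "wip (A + C) x y = wip A x y + wip C x y"
  and wip_matrix_diff: "wip (A - C) x y = wip A x y - wip C x y"
  and wip_matrix_scaleR: "wip (t *\<^sub>R A) x y = t * wip A x y"
  by (simp_all add: wip_def matrix_vector_mult_add_rdistrib matrix_vector_mult_diff_rdistrib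
      scaleR_matrix_vector_assoc [symmetric] inner_add_right inner_diff_right)

lemmas wip_matrix_linear = wip_matrix_add wip_matrix_diff wip_matrix_scaleR

lemma wip_commute: "transpose A = A \<Longrightarrow> wip A x y = wip A y x"
  unfolding wip_def by (metis dot_lmul_matrix inner_commute transpose_matrix_vector)

lemma wip_eq_sum: "wip A x y = (\<Sum>a\<in>UNIV. \<Sum>b\<in>UNIV. A $ a $ b * (x $ a * y $ b))"
  by (simp add: wip_def inner_vec_def matrix_vector_mult_def sum_distrib_left mult_ac)

lemma wip_scaleR_mat: "wip (l *\<^sub>R mat 1) x y = l * (x \<bullet> y)"
  by (simp add: wip_def scaleR_matrix_vector_assoc [symmetric])

lemma wnorm2_add: "transpose A = A \<Longrightarrow> wnorm2 A (x + y) = wnorm2 A x + 2 * wip A x y + wnorm2 A y"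
  and wnorm2_diff: "transpose A = A \<Longrightarrow> wnorm2 A (x - y) = wnorm2 A x - 2 * wip A x y + wnorm2 A y"
  using wip_commute [of A x y] by (simp_all add: wnorm2_def wip_linear)

lemma wnorm2_scaleR: "wnorm2 A (t *\<^sub>R x) = t\<^sup>2 * wnorm2 A x"
  by (simp add: wnorm2_def wip_linear power2_eq_square)

lemma wnorm2_minus [simp]: "wnorm2 A (- x) = wnorm2 A x"
  by (simp add: wnorm2_def wip_linear)

lemma wnorm2_zero [simp]: "wnorm2 A 0 = 0"
  by (simp add: wnorm2_def)

lemma pos_def_imp_symmetric: "pos_def A \<Longrightarrow> transpose A = A"
  by (simp add: pos_def_def)

lemma pos_def_imp_wnorm2_nonneg: "pos_def A \<Longrightarrow> 0 \<le> wnorm2 A x"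
  by (cases "x = 0") (auto simp: pos_def_def less_imp_le)

lemma wip_young:
  assumes "transpose A = A" and nonneg: "\<And>x. 0 \<le> wnorm2 A x" and "0 < e"
  shows "2 * wip A x y \<le> e * wnorm2 A x + wnorm2 A y / e"
proof -
  have "0 \<le> wnorm2 A (e *\<^sub>R x - y)" by (rule nonneg)
  also have "\<dots> = e * (e * wnorm2 A x - 2 * wip A x y) + wnorm2 A y"
    by (simp add: wnorm2_diff assms wnorm2_scaleR wip_linear algebra_simps power2_eq_square)
  finally have "0 \<le> (e * (e * wnorm2 A x - 2 * wip A x y) + wnorm2 A y) / e"
    using \<open>0 < e\<close> by simp
  then show ?thesis using \<open>0 < e\<close> by (simp add: add_divide_distrib)
qed

lemma wnorm2_add_le:
  assumes "transpose A = A" and nonneg: "\<And>x. 0 \<le> wnorm2 A x"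
  shows "wnorm2 A (x + y) \<le> 2 * wnorm2 A x + 2 * wnorm2 A y"
  using wip_young [OF assms, of 1 x y] by (simp add: wnorm2_add assms)

text \<open>A zero of a semidefinite form is a minimum, so the gradient
  \<open>2 *\<^sub>R (A *v v)\<close> vanishes there. The proof moves from \<open>v\<close> by
  \<open>t\<close> against \<open>A *v v\<close>, divides the change of the form by
  \<open>t\<close>, and lets \<open>t\<close> tend to 0 from above.\<close>

lemma wnorm2_zero_imp_kernel:
  assumes sym: "transpose A = A" and nonneg: "\<And>x. 0 \<le> wnorm2 A x" and "wnorm2 A v = 0"
  shows "A *v v = 0"
proof -
  have "2 * (norm (A *v v))\<^sup>2 \<le> t * wnorm2 A (A *v v)" if "t > 0" for t
  proof -
    have "0 \<le> wnorm2 A (v - t *\<^sub>R (A *v v))" by (rule nonneg)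
    also have "\<dots> = t * (t * wnorm2 A (A *v v) - 2 * wip A (A *v v) v)"
      using wip_commute [OF sym, of v] by (simp add: wnorm2_diff sym \<open>wnorm2 A v = 0\<close> wnorm2_scaleR
          wip_linear power2_eq_square algebra_simps)
    finally show ?thesis using that by (simp add: zero_le_mult_iff wip_def power2_norm_eq_inner)
  qed
  then have "\<forall>\<^sub>F t in at_right 0. 2 * (norm (A *v v))\<^sup>2 \<le> t * wnorm2 A (A *v v)"
    by (rule eventually_mono [OF eventually_at_right_less])
  moreover have "((\<lambda>t. t * wnorm2 A (A *v v)) \<longlongrightarrow> 0 * wnorm2 A (A *v v)) (at_right 0)"
    by (intro tendsto_intros)
  ultimately have "2 * (norm (A *v v))\<^sup>2 \<le> 0 * wnorm2 A (A *v v)"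
    by (intro tendsto_lowerbound) auto
  then show ?thesis by simp
qed

text \<open>Rayleigh quotient: \<open>l\<close> is the minimum of the form on the unit sphere,
  attained at \<open>v\<close>. Then \<open>A - l *\<^sub>R mat 1\<close> is semidefinite and its
  form vanishes at \<open>v\<close>, so \<open>v\<close> lies in its kernel.\<close>

lemma symmetric_min_eigenvector:
  fixes A :: "real^'m^'m"
  assumes sym: "transpose A = A"
  obtains l v where "v \<noteq> 0" "A *v v = l *\<^sub>R v" "\<And>x. l * (norm x)\<^sup>2 \<le> wnorm2 A x"
proof -
  have "continuous_on (sphere 0 1) (wnorm2 A)"
    unfolding wnorm2_def wip_def by (intro continuous_intros)
  moreover have "sphere 0 1 \<noteq> ({} :: (real^'m) set)" by simp
  ultimately obtain v where v: "norm v = 1" and min: "\<And>y. norm y = 1 \<Longrightarrow> wnorm2 A v \<le> wnorm2 A y"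
    using continuous_attains_inf [of "sphere 0 1 :: (real^'m) set" "wnorm2 A"] by auto
  define l where "l = wnorm2 A v"
  have ge: "l * (norm x)\<^sup>2 \<le> wnorm2 A x" for x
  proof (cases "x = 0")
    case False
    have "l \<le> wnorm2 A ((1 / norm x) *\<^sub>R x)" unfolding l_def using False by (intro min) simp
    then show ?thesis using False by (simp add: wnorm2_scaleR power_divide field_simps)
  qed simp
  let ?A' = "A - l *\<^sub>R mat 1"
  have w: "wnorm2 ?A' x = wnorm2 A x - l * (norm x)\<^sup>2" for x
    unfolding wnorm2_def wip_matrix_diff wip_scaleR_mat by (simp add: power2_norm_eq_inner)
  have "transpose ?A' = ?A'"
    using sym by (simp add: vec_eq_iff transpose_def mat_def)
  then have "?A' *v v = 0"
    by (rule wnorm2_zero_imp_kernel) (use ge w v l_def in auto)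
  then have "A *v v = l *\<^sub>R v"
    by (simp add: matrix_vector_mult_diff_rdistrib scaleR_matrix_vector_assoc [symmetric])
  moreover have "v \<noteq> 0" using v by auto
  ultimately show ?thesis using ge that by blast
qed

text \<open>\<open>Min\<close> and \<open>Max\<close> of the spectrum are meaningful only for a
  finite set. Eigenvectors of distinct eigenvalues are orthogonal, hence independent, and one can be
  chosen injectively for each eigenvalue.\<close>

lemma finite_eigenvalues_symmetric:
  fixes A :: "real^'m^'m"
  assumes sym: "transpose A = A"
  shows "finite (eigenvalues A)"
proof -
  obtain ev where ev: "\<And>l. l \<in> eigenvalues A \<Longrightarrow> ev l \<noteq> 0 \<and> A *v ev l = l *\<^sub>R ev l"
  proof -
    have "\<forall>l\<in>eigenvalues A. \<exists>v. v \<noteq> 0 \<and> A *v v = l *\<^sub>R v" by (simp add: eigenvalues_def)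
    from bchoice [OF this] show ?thesis using that by blast
  qed
  have orth: "ev l \<bullet> ev m = 0" if "l \<in> eigenvalues A" "m \<in> eigenvalues A" "l \<noteq> m" for l m
    using wip_commute [OF sym, of "ev l" "ev m"] ev [OF that(1)] ev [OF that(2)] that(3)
    by (simp add: wip_def inner_commute)
  have inj: "inj_on ev (eigenvalues A)"
  proof (intro inj_onI, rule ccontr)
    fix l m assume lm: "l \<in> eigenvalues A" "m \<in> eigenvalues A" "ev l = ev m" "l \<noteq> m"
    then have "ev l \<bullet> ev l = 0" using orth [of l m] by simp
    then show False using ev lm by simp
  qed
  have "pairwise orthogonal (ev ` eigenvalues A)"
    by (auto simp: pairwise_def orthogonal_def intro!: orth)
  moreover have "0 \<notin> ev ` eigenvalues A" using ev by auto
  ultimately have "independent (ev ` eigenvalues A)" by (rule pairwise_orthogonal_independent)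
  then show ?thesis using independent_imp_finite finite_imageD inj by blast
qed

lemma eigenvalue_eq_quotient: "A *v v = l *\<^sub>R v \<Longrightarrow> wnorm2 A v = l * (norm v)\<^sup>2"
  by (simp add: wnorm2_def wip_def power2_norm_eq_inner)

lemma lambda_min_le:
  fixes A :: "real^'m^'m"
  assumes sym: "transpose A = A"
  shows "lambda_min A * (norm x)\<^sup>2 \<le> wnorm2 A x"
proof -
  obtain l v where "v \<noteq> 0" "A *v v = l *\<^sub>R v" and l: "\<And>x. l * (norm x)\<^sup>2 \<le> wnorm2 A x"
    using symmetric_min_eigenvector [OF sym] by blast
  then have "l \<in> eigenvalues A" by (auto simp: eigenvalues_def)
  then have "lambda_min A \<le> l"
    unfolding lambda_min_def using finite_eigenvalues_symmetric [OF sym] by simp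
  then have "lambda_min A * (norm x)\<^sup>2 \<le> l * (norm x)\<^sup>2" by (simp add: mult_right_mono)
  then show ?thesis using l order_trans by blast
qed

lemma lambda_min_in_eigenvalues:
  fixes A :: "real^'m^'m"
  assumes sym: "transpose A = A"
  shows "lambda_min A \<in> eigenvalues A"
proof -
  obtain l v where "v \<noteq> 0" "A *v v = l *\<^sub>R v"
    using symmetric_min_eigenvector [OF sym] by blast
  then have "eigenvalues A \<noteq> {}" by (auto simp: eigenvalues_def)
  then show ?thesis
    unfolding lambda_min_def by (intro Min_in finite_eigenvalues_symmetric [OF sym])
qed

lemma eigenvalues_uminus: "eigenvalues (- A) = uminus ` eigenvalues A"
proof -
  have "(- A) *v v = l *\<^sub>R v \<longleftrightarrow> A *v v = (- l) *\<^sub>R v" for v l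
  proof -
    have "(- A) *v v = - (A *v v)" using matrix_vector_mult_diff_rdistrib [of 0 A v] by simp
    then show ?thesis using minus_equation_iff [of "A *v v" "l *\<^sub>R v"] by auto
  qed
  then have "l \<in> eigenvalues (- A) \<longleftrightarrow> - l \<in> eigenvalues A" for l
    by (simp add: eigenvalues_def)
  moreover have "l \<in> uminus ` eigenvalues A \<longleftrightarrow> - l \<in> eigenvalues A" for l
    by (force simp: image_iff)
  ultimately show ?thesis by blast
qed

lemma transpose_uminus: "transpose (- A) = - transpose A"
  and transpose_add: "transpose (A + C) = transpose A + transpose C"
  and transpose_diff: "transpose (A - C) = transpose A - transpose C"
  by (simp_all add: vec_eq_iff transpose_def)

lemma lambda_max_eq_uminus:
  fixes A :: "real^'m^'m"
  assumes sym: "transpose A = A"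
  shows "lambda_max A = - lambda_min (- A)"
proof -
  have "eigenvalues A \<noteq> {}" using lambda_min_in_eigenvalues [OF sym] by auto
  then show ?thesis
    unfolding lambda_min_def lambda_max_def eigenvalues_uminus
    using minus_Max_eq_Min [OF finite_eigenvalues_symmetric [OF sym]] by simp
qed

lemma le_lambda_max:
  fixes A :: "real^'m^'m"
  assumes sym: "transpose A = A"
  shows "wnorm2 A x \<le> lambda_max A * (norm x)\<^sup>2"
proof -
  have "lambda_min (- A) * (norm x)\<^sup>2 \<le> wnorm2 (- A) x"
    by (rule lambda_min_le) (simp add: transpose_uminus sym)
  moreover have "wnorm2 (- A) x = - wnorm2 A x"
    using wip_matrix_diff [of 0 A x x] by (simp add: wnorm2_def wip_def)
  ultimately show ?thesis by (simp add: lambda_max_eq_uminus sym)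
qed

lemma lambda_max_in_eigenvalues:
  fixes A :: "real^'m^'m"
  assumes sym: "transpose A = A"
  shows "lambda_max A \<in> eigenvalues A"
  using lambda_min_in_eigenvalues [of "- A"] sym
  by (auto simp: lambda_max_eq_uminus transpose_uminus eigenvalues_uminus)

lemma eigenvalue_nonneg:
  assumes "\<And>x. 0 \<le> wnorm2 A x" and "l \<in> eigenvalues A"
  shows "0 \<le> l"
proof -
  obtain v where "v \<noteq> 0" "A *v v = l *\<^sub>R v" using assms(2) by (auto simp: eigenvalues_def)
  with assms(1) [of v] show ?thesis by (simp add: eigenvalue_eq_quotient zero_le_mult_iff)
qed

lemma lambda_min_pos_def:
  fixes A :: "real^'m^'m"
  assumes "pos_def A"
  shows "0 < lambda_min A"
proof -
  obtain v where "v \<noteq> 0" "A *v v = lambda_min A *\<^sub>R v"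
    using lambda_min_in_eigenvalues pos_def_imp_symmetric [OF assms] by (force simp: eigenvalues_def)
  moreover have "0 < wnorm2 A v" using assms \<open>v \<noteq> 0\<close> by (simp add: pos_def_def)
  ultimately show ?thesis by (simp add: eigenvalue_eq_quotient zero_less_mult_iff)
qed

section \<open>Block-diagonal matrices and their extreme eigenvalues\<close>

lemma transpose_block_diag:
  "transpose (block_diag A) = block_diag (\<lambda>i. transpose (A i))"
  by (auto simp: vec_eq_iff transpose_def block_diag_def)

lemma block_diag_linear:
  "block_diag A + block_diag C = block_diag (\<lambda>i. A i + C i)"
  "block_diag A - block_diag C = block_diag (\<lambda>i. A i - C i)"
  "t *\<^sub>R block_diag A = block_diag (\<lambda>i. t *\<^sub>R A i)"
  by (auto simp: vec_eq_iff block_diag_def)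

lemma wnorm2_block_diag: "wnorm2 (block_diag A) (col X) = (\<Sum>i\<in>UNIV. wnorm2 (A i) (X i))"
proof -
  have inner: "(\<Sum>j\<in>UNIV. \<Sum>b\<in>UNIV. (if i = j then A i $ a $ b else 0) * (X i $ a * X j $ b))
      = (\<Sum>b\<in>UNIV. A i $ a $ b * (X i $ a * X i $ b))" for i a
  proof -
    have "(\<Sum>b\<in>UNIV. (if i = j then A i $ a $ b else 0) * (X i $ a * X j $ b))
        = (if i = j then (\<Sum>b\<in>UNIV. A i $ a $ b * (X i $ a * X i $ b)) else 0)" for j
      by auto
    then show ?thesis by simp
  qed
  show ?thesis
    unfolding wnorm2_def wip_eq_sum UNIV_Times_UNIV [symmetric] sum.cartesian_product' block_diag_def col_def
      vec_lambda_beta fst_conv snd_conv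
    by (simp add: inner)
qed

lemma norm_col: "(norm (col X))\<^sup>2 = (\<Sum>i\<in>UNIV. (norm (X i))\<^sup>2)"
  unfolding power2_norm_eq_inner inner_vec_def UNIV_Times_UNIV [symmetric] sum.cartesian_product' col_def
  by simp

lemma col_diff: "col X - col Y = col (\<lambda>i. X i - Y i)"
  by (simp add: col_def vec_eq_iff)

text \<open>Test the stacked matrix on a vector that is zero outside block \<open>i\<close>. This
  turns the step-size conditions, which speak of stacked matrices, into conditions for each agent
  separately.\<close>

lemma lambda_block_diag:
  fixes A :: "'r::finite \<Rightarrow> real^'n^'n"
  assumes "\<And>i. transpose (A i) = A i"
  shows "lambda_min (block_diag A) * (norm v)\<^sup>2 \<le> wnorm2 (A i) v"
    and "wnorm2 (A i) v \<le> lambda_max (block_diag A) * (norm v)\<^sup>2"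
proof -
  have sym: "transpose (block_diag A) = block_diag A" by (simp add: transpose_block_diag assms)
  let ?X = "\<lambda>j. if j = i then v else 0"
  have "wnorm2 (block_diag A) (col ?X) = wnorm2 (A i) v"
    unfolding wnorm2_block_diag by (subst sum.remove [of _ i]) auto
  moreover have "(norm (col ?X))\<^sup>2 = (norm v)\<^sup>2"
    unfolding norm_col by (subst sum.remove [of _ i]) auto
  ultimately show "lambda_min (block_diag A) * (norm v)\<^sup>2 \<le> wnorm2 (A i) v"
    and "wnorm2 (A i) v \<le> lambda_max (block_diag A) * (norm v)\<^sup>2"
    using lambda_min_le [OF sym, of "col ?X"] le_lambda_max [OF sym, of "col ?X"] by auto
qed

lemma lambda_block_diag_nonneg:
  fixes A :: "'r::finite \<Rightarrow> real^'n^'n"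
  assumes "\<And>i. transpose (A i) = A i" and "\<And>i v. 0 \<le> wnorm2 (A i) v"
  shows "0 \<le> lambda_min (block_diag A)" and "0 \<le> lambda_max (block_diag A)"
proof -
  have sym: "transpose (block_diag A) = block_diag A" by (simp add: transpose_block_diag assms)
  have "0 \<le> wnorm2 (block_diag A) x" for x
  proof -
    have "x = col (\<lambda>i. \<chi> a. x $ (i, a))" by (simp add: col_def vec_eq_iff)
    then have "wnorm2 (block_diag A) x = (\<Sum>i\<in>UNIV. wnorm2 (A i) (\<chi> a. x $ (i, a)))"
      by (metis wnorm2_block_diag)
    then show ?thesis by (simp add: sum_nonneg assms)
  qed
  then show "0 \<le> lambda_min (block_diag A)" "0 \<le> lambda_max (block_diag A)"
    using eigenvalue_nonneg lambda_min_in_eigenvalues [OF sym] lambda_max_in_eigenvalues [OF sym]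
    by blast+
qed

section \<open>Sketching projections and proximal steps\<close>

lemma matrix_mult_add_rdistrib: "(C'' + D'') ** (A'' :: real^'n^'m) = C'' ** A'' + D'' ** A''"
  and matrix_mult_diff_ldistrib: "(A :: real^'n^'m) ** (C - D) = A ** C - A ** D"
  and matrix_mult_diff_rdistrib: "(C' - D') ** (A' :: real^'n^'m) = C' ** A' - D' ** A'"
  by (simp_all add: vec_eq_iff matrix_matrix_mult_def algebra_simps sum_subtractf sum.distrib)

lemma wip_axis: "wip A (axis i 1) (axis j 1) = A $ i $ j"
  by (simp add: wip_def matrix_vector_mult_basis column_def inner_axis')

lemma orthogonal_projection_matrix_exists:
  fixes N :: "(real^'n) set"
  assumes "subspace N"
  obtains P :: "real^'n^'n" where "transpose P = P" "\<And>x. P *v x \<in> N" "\<And>x. x \<in> N \<Longrightarrow> P *v x = x"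
proof -
  obtain B where B: "B \<subseteq> N" "pairwise orthogonal B" "\<And>x. x \<in> B \<Longrightarrow> norm x = 1"
    "independent B" "span B = N"
    using orthonormal_basis_subspace [OF assms] by metis
  have fin: "finite B" using B(4) independent_imp_finite by blast
  define p where "p x = (\<Sum>b\<in>B. (b \<bullet> x) *\<^sub>R b)" for x
  have "linear p"
    by (rule linearI) (simp_all add: p_def inner_add_right scaleR_add_left sum.distrib scaleR_sum_right)
  then have P: "matrix p *v x = p x" for x by (simp add: matrix_vector_mul(3))
  have pN: "p x \<in> N" for x
    unfolding p_def using B(1) by (intro subspace_sum subspace_scale assms) auto
  have "p x = x" if "x \<in> N" for x
  proof -
    have "orthogonal (x - p x) b" if "b \<in> B" for b
    proof -
      have "b \<bullet> p x = (\<Sum>b'\<in>B. (b' \<bullet> x) * (b \<bullet> b'))" by (simp add: p_def inner_sum_right)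
      also have "\<dots> = (\<Sum>b'\<in>B. if b' = b then b \<bullet> x else 0)"
        using B(2,3) that by (intro sum.cong) (auto simp: pairwise_def orthogonal_def norm_eq_1)
      also have "\<dots> = b \<bullet> x" using that fin by simp
      finally show ?thesis by (simp add: orthogonal_def inner_commute [of _ b] inner_diff_right)
    qed
    moreover have "x - p x \<in> span B" using B(5) that pN subspace_diff [OF assms] by blast
    ultimately have "orthogonal (x - p x) (x - p x)" using orthogonal_to_span by blast
    then show ?thesis by (simp add: orthogonal_def)
  qed
  moreover have "wip (matrix p) x y = wip (matrix p) y x" for x y
    by (simp add: wip_def P p_def inner_sum_right mult_ac inner_commute)
  then have "transpose (matrix p) = matrix p"
    by (simp add: vec_eq_iff transpose_def) (metis wip_axis)
  ultimately show ?thesis using that P pN by metis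
qed

definition penrose_inverse :: "real^'n^'m \<Rightarrow> real^'m^'n \<Rightarrow> bool" where
  "penrose_inverse A X \<longleftrightarrow> A ** X ** A = A \<and> X ** A ** X = X \<and>
     transpose (A ** X) = A ** X \<and> transpose (X ** A) = X ** A"

text \<open>\<open>A ** X\<close> and \<open>A ** Y\<close> are both the orthogonal projection onto
  the range of \<open>A\<close>; likewise \<open>X ** A\<close> and \<open>Y ** A\<close> coincide.
  Then X = X A X = Y A Y = Y. Uniqueness is what gives the \<open>THE\<close> in
  \<open>pseudo_inverse\<close> a value.\<close>

lemma penrose_inverse_unique:
  assumes X: "penrose_inverse A X" and Y: "penrose_inverse A Y"
  shows "X = Y"
proof -
  have "A ** X = transpose ((A ** Y) ** (A ** X))"
    using X Y by (simp add: penrose_inverse_def matrix_mul_assoc)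
  also have "\<dots> = (A ** X) ** (A ** Y)"
    using X Y by (simp add: penrose_inverse_def matrix_transpose_mul)
  also have "\<dots> = A ** Y" using X by (simp add: penrose_inverse_def matrix_mul_assoc)
  finally have 1: "A ** X = A ** Y" .
  have "X ** A = transpose ((X ** A) ** (Y ** A))"
    using X Y by (simp add: penrose_inverse_def) (metis matrix_mul_assoc)
  also have "\<dots> = (Y ** A) ** (X ** A)"
    using X Y by (simp add: penrose_inverse_def matrix_transpose_mul)
  also have "\<dots> = Y ** A" using X by (simp add: penrose_inverse_def) (metis matrix_mul_assoc)
  finally have 2: "X ** A = Y ** A" .
  have "X = X ** (A ** X)" using X by (simp add: penrose_inverse_def matrix_mul_assoc)
  also have "\<dots> = (Y ** A) ** Y" using 1 2 by (simp add: matrix_mul_assoc)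
  also have "\<dots> = Y" using Y by (simp add: penrose_inverse_def)
  finally show ?thesis .
qed

text \<open>With \<open>R\<close> the orthogonal projection onto the kernel of \<open>A\<close>, the matrix \<open>A + R\<close> is invertible
  and \<open>(A + R)\<inverse> - R\<close> is the pseudo-inverse.\<close>

lemma symmetric_penrose_inverse_exists:
  fixes A :: "real^'n^'n"
  assumes sym: "transpose A = A"
  obtains X where "penrose_inverse A X" "transpose X = X"
proof -
  have "subspace {x. A *v x = 0}"
    by (auto simp: subspace_def matrix_vector_right_distrib matrix_vector_mult_scaleR)
  then obtain R where R: "transpose R = R" "\<And>x. A *v (R *v x) = 0" "\<And>x. A *v x = 0 \<Longrightarrow> R *v x = x"
    using orthogonal_projection_matrix_exists [of "{x. A *v x = 0}"] by auto
  have AR: "A ** R = 0" using R(2) by (simp add: matrix_eq matrix_vector_mul_assoc [symmetric])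
  then have RA: "R ** A = 0"
    using matrix_transpose_mul [of A R] R(1) sym by (simp add: transpose_def vec_eq_iff)
  have RR: "R ** R = R" using R(2,3) by (simp add: matrix_eq matrix_vector_mul_assoc [symmetric])
  define C where "C = A + R"
  have "x = 0" if "C *v x = 0" for x
  proof -
    have *: "A *v x + R *v x = 0" using that by (simp add: C_def matrix_vector_mult_add_rdistrib)
    then have "R *v (A *v x + R *v x) = 0" by simp
    then have "R *v x = 0"
      by (simp add: matrix_vector_right_distrib matrix_vector_mul_assoc RA RR)
    then show ?thesis using * R(3) [of x] by simp
  qed
  then obtain D where DC: "D ** C = mat 1"
    using matrix_left_invertible_ker [of C] by blast
  then have CD: "C ** D = mat 1" by (simp add: matrix_left_right_inverse)
  have symC: "transpose C = C" by (simp add: C_def transpose_add sym R)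
  have "transpose D ** C = mat 1"
    using CD matrix_transpose_mul [of C D] symC by (simp add: transpose_mat)
  then have symD: "transpose D = D"
    using CD by (metis matrix_mul_assoc matrix_mul_lid matrix_mul_rid)
  have CR: "C ** R = R" by (simp add: C_def matrix_mult_add_rdistrib AR RR)
  have RC: "R ** C = R" by (simp add: C_def matrix_add_ldistrib RA RR)
  have DR: "D ** R = R" by (metis CR DC matrix_mul_assoc matrix_mul_lid)
  have RD: "R ** D = R" by (metis RC CD matrix_mul_assoc matrix_mul_rid)
  have A: "A = C - R" by (simp add: C_def)
  define X where "X = D - R"
  have AX: "A ** X = mat 1 - R"
    by (simp add: A X_def matrix_mult_diff_ldistrib matrix_mult_diff_rdistrib CD CR RD RR)
  have XA: "X ** A = mat 1 - R"
    by (simp add: A X_def matrix_mult_diff_ldistrib matrix_mult_diff_rdistrib DC DR RC RR)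
  have "penrose_inverse A X"
    unfolding penrose_inverse_def AX XA
    by (simp add: matrix_mult_diff_rdistrib RA transpose_diff transpose_mat R)
      (simp add: X_def matrix_mult_diff_ldistrib RD RR)
  moreover have "transpose X = X" by (simp add: X_def transpose_diff symD R)
  ultimately show ?thesis using that by blast
qed

lemma pseudo_inverse_symmetric:
  fixes A :: "real^'n^'n"
  assumes "transpose A = A"
  shows "pseudo_inverse A ** A ** pseudo_inverse A = pseudo_inverse A"
    and "transpose (pseudo_inverse A) = pseudo_inverse A"
proof -
  obtain X where X: "penrose_inverse A X" "transpose X = X"
    using symmetric_penrose_inverse_exists [OF assms] by blast
  have "pseudo_inverse A = X"
    unfolding pseudo_inverse_def penrose_inverse_def [symmetric]
    using X(1) penrose_inverse_unique by blast
  then show "pseudo_inverse A ** A ** pseudo_inverse A = pseudo_inverse A"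
    and "transpose (pseudo_inverse A) = pseudo_inverse A"
    using X by (simp_all add: penrose_inverse_def)
qed

section \<open>The sketched projection in the inner product of a positive definite weight\<close>

lemma pos_def_matrix_inv:
  fixes W :: "real^'n^'n"
  assumes "pos_def W"
  shows "W ** matrix_inv W = mat 1" and "matrix_inv W ** W = mat 1"
    and "transpose (matrix_inv W) = matrix_inv W"
proof -
  have "x = 0" if "W *v x = 0" for x
  proof (rule ccontr)
    assume "x \<noteq> 0"
    then have "0 < wnorm2 W x" using assms by (simp add: pos_def_def)
    then show False using that by (simp add: wnorm2_def wip_def)
  qed
  then have "invertible W"
    using matrix_left_invertible_ker [of W] by (auto simp: invertible_left_inverse)
  then have "W ** matrix_inv W = mat 1 \<and> matrix_inv W ** W = mat 1"
    unfolding invertible_def matrix_inv_def by (rule someI_ex)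
  then show 1: "W ** matrix_inv W = mat 1" and 2: "matrix_inv W ** W = mat 1"
    by simp_all
  have "transpose (matrix_inv W) ** W = mat 1"
    using 1 matrix_transpose_mul [of W "matrix_inv W"] pos_def_imp_symmetric [OF assms]
    by (simp add: transpose_mat)
  then show "transpose (matrix_inv W) = matrix_inv W"
    using 1 by (metis matrix_mul_assoc matrix_mul_lid matrix_mul_rid)
qed

text \<open>With \<open>A\<close> the inner matrix of the sketch, the product collapses by the
  Penrose equation X A X = X, so rank-deficient sketches are covered as well. Together the two facts
  say that \<open>matrix_inv W ** sketch_mat W S\<close> is an orthogonal projection in the inner
  product of \<open>W\<close>.\<close>

lemma sketch_mat_props:
  fixes W :: "real^'n^'n" and S :: "real^'p^'n"
  assumes "pos_def W"
  shows "transpose (sketch_mat W S) = sketch_mat W S"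
    and "sketch_mat W S ** matrix_inv W ** sketch_mat W S = sketch_mat W S"
proof -
  define A where "A = transpose S ** matrix_inv W ** S"
  have "transpose A = A"
    by (simp add: A_def matrix_transpose_mul pos_def_matrix_inv [OF assms] matrix_mul_assoc)
  note X = pseudo_inverse_symmetric [OF this]
  have M: "sketch_mat W S = S ** pseudo_inverse A ** transpose S"
    by (simp add: sketch_mat_def A_def)
  show "transpose (sketch_mat W S) = sketch_mat W S"
    by (simp add: M matrix_transpose_mul X matrix_mul_assoc)
  have "sketch_mat W S ** matrix_inv W ** sketch_mat W S
      = S ** (pseudo_inverse A ** A ** pseudo_inverse A) ** transpose S"
    by (simp add: M A_def matrix_mul_assoc)
  then show "sketch_mat W S ** matrix_inv W ** sketch_mat W S = sketch_mat W S"
    by (simp add: X M)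
qed

text \<open>Inner products of projected vectors become forms of the sketched matrix itself. These
  are linear in that matrix, which is what lets an expectation act on the matrix alone.\<close>

lemma sketch_direction:
  fixes W :: "real^'n^'n" and S :: "real^'p^'n"
  assumes "pos_def W"
  shows "wip W y (matrix_inv W *v (sketch_mat W S *v v)) = wip (sketch_mat W S) y v"
    and "wip W (matrix_inv W *v (sketch_mat W S *v u)) (matrix_inv W *v (sketch_mat W S *v v))
      = wip (sketch_mat W S) u v"
    and "wnorm2 W (matrix_inv W *v (sketch_mat W S *v v)) = wnorm2 (sketch_mat W S) v"
proof -
  show 1: "wip W y (matrix_inv W *v (sketch_mat W S *v v)) = wip (sketch_mat W S) y v" for y v
    by (simp add: wip_def matrix_vector_mul_assoc matrix_mul_assoc pos_def_matrix_inv [OF assms])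
  let ?M = "sketch_mat W S"
  note sym = sketch_mat_props(1) [OF assms, of S]
  show 2: "wip W (matrix_inv W *v (?M *v u)) (matrix_inv W *v (?M *v v)) = wip ?M u v" for u v
  proof -
    have "wip W (matrix_inv W *v (?M *v u)) (matrix_inv W *v (?M *v v))
        = wip ?M v (matrix_inv W *v (?M *v u))"
      by (simp add: 1 wip_commute [OF sym, of v])
    also have "\<dots> = wip ?M v u"
      by (simp add: wip_def matrix_vector_mul_assoc matrix_mul_assoc sketch_mat_props [OF assms])
    finally show ?thesis by (simp add: wip_commute [OF sym, of v])
  qed
  show "wnorm2 W (matrix_inv W *v (?M *v v)) = wnorm2 ?M v"
    unfolding wnorm2_def by (rule 2)
qed

lemma sketch_mat_wnorm2_nonneg: "pos_def W \<Longrightarrow> 0 \<le> wnorm2 (sketch_mat W S) v"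
  by (metis sketch_direction(3) pos_def_imp_wnorm2_nonneg)

text \<open>Used twice: \<open>t = 1\<close> shows that the sketched matrix is dominated by
  \<open>W\<close>, and \<open>t = th S\<close>, after averaging, that \<open>W\<close> is dominated
  by the second moment.\<close>

lemma sketch_residual:
  fixes W :: "real^'n^'n" and S :: "real^'p^'n"
  assumes "pos_def W"
  shows "wnorm2 W (v - t *\<^sub>R (matrix_inv W *v (sketch_mat W S *v v)))
      = wnorm2 W v - 2 * t * wnorm2 (sketch_mat W S) v + t\<^sup>2 * wnorm2 (sketch_mat W S) v"
  by (simp add: wnorm2_diff pos_def_imp_symmetric [OF assms] wnorm2_scaleR wip_linear
      sketch_direction [OF assms]) (simp add: wnorm2_def)

section \<open>Subgradients of the penalty norm, of convex functions, and proximal points\<close>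

lemma lp_norm_scaleR:
  assumes "0 < a"
  shows "lp_norm a (t *\<^sub>R x) = \<bar>t\<bar> * lp_norm a x"
proof -
  have "(\<Sum>j\<in>UNIV. \<bar>(t *\<^sub>R x) $ j\<bar> powr a) = \<bar>t\<bar> powr a * (\<Sum>j\<in>UNIV. \<bar>x $ j\<bar> powr a)"
    by (simp add: sum_distrib_left abs_mult powr_mult)
  then show ?thesis
    using assms by (simp add: lp_norm_def powr_mult sum_nonneg powr_powr)
qed

lemma lp_norm_axis: "lp_norm a (axis j 1) = 1"
proof -
  have "(\<Sum>i\<in>UNIV. \<bar>axis j (1::real) $ i\<bar> powr a) = (\<Sum>i\<in>UNIV. if i = j then 1 else 0)"
    by (rule sum.cong) (auto simp: axis_def)
  then show ?thesis by (simp add: lp_norm_def)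
qed

text \<open>Homogeneity alone makes a subgradient a functional below the norm, so that no Minkowski
  inequality is needed.\<close>

lemma lp_norm_subgradient_bound:
  fixes s :: "real^'n"
  assumes "0 < a" and s: "s \<in> subdiff (mat 1) (\<lambda>v. ereal (lp_norm a v)) x"
  shows "norm s \<le> sqrt (real CARD('n))"
proof -
  have sub: "lp_norm a x + s \<bullet> (y - x) \<le> lp_norm a y" for y
    using s by (simp add: subdiff_def wip_def)
  \<comment> \<open>The test points \<open>2 *\<^sub>R x\<close> and 0 give the two opposite
    inequalities.\<close>
  have "s \<bullet> x = lp_norm a x"
    using sub [of "2 *\<^sub>R x"] sub [of "0 *\<^sub>R x"] lp_norm_scaleR [OF \<open>0 < a\<close>, of 0 x]
      lp_norm_scaleR [OF \<open>0 < a\<close>, of 2 x]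
    by (simp add: inner_diff_right)
  then have le: "s \<bullet> y \<le> lp_norm a y" for y
    using sub [of y] by (simp add: inner_diff_right)
  \<comment> \<open>Both signed unit vectors have norm 1 for every exponent, so the resulting bound
    does not depend on \<open>a\<close>.\<close>
  have "\<bar>s $ j\<bar> \<le> 1" for j
    using le [of "axis j 1"] le [of "(-1) *\<^sub>R axis j 1"] lp_norm_scaleR [OF \<open>0 < a\<close>, of "-1" "axis j 1"]
    by (simp add: lp_norm_axis inner_axis)
  then have "(\<Sum>j\<in>UNIV. (s $ j)\<^sup>2) \<le> (\<Sum>j\<in>(UNIV::'n set). 1)"
    by (intro sum_mono) (simp add: abs_le_square_iff [of _ 1, simplified])
  then show ?thesis by (simp add: norm_vec_def L2_set_def)
qed

text \<open>First-order optimality for a sum of a convex function and a function that is merely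
  differentiable at the minimizer. Convexity of \<open>r\<close> bounds the difference quotient of
  \<open>g\<close> along the segment to \<open>y\<close>, and the one-sided limit yields the
  subgradient inequality. It serves both the proximal step and the network with a single reliable
  agent.\<close>

lemma minimizer_subgradient:
  assumes cpc: "closed_proper_convex r"
    and der: "(g has_derivative (\<lambda>v. wip W \<gamma> v)) (at x)"
    and min: "\<And>y. ereal (g x) + r x \<le> ereal (g y) + r y"
  shows "- \<gamma> \<in> subdiff W r x"
proof -
  have ninf: "r y \<noteq> -\<infinity>" for y using cpc by (simp add: closed_proper_convex_def)
  obtain y0 where "r y0 \<noteq> \<infinity>" using cpc by (auto simp: closed_proper_convex_def)
  with min [of y0] ninf have "r x \<noteq> \<infinity>" by (cases "r y0") auto
  then obtain rx where rx: "r x = ereal rx" using ninf [of x] by (cases "r x") auto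
  have conv: "convex {(x, t). r x \<le> ereal t}" using cpc by (simp add: closed_proper_convex_def)
  have "r x + ereal (wip W (- \<gamma>) (y - x)) \<le> r y" for y
  proof (cases "r y = \<infinity>")
    case False
    then obtain ry where ry: "r y = ereal ry" using ninf [of y] by (cases "r y") auto
    have quot: "rx - ry \<le> (g (x + t *\<^sub>R (y - x)) - g x) / t" if "0 < t" "t < 1" for t
    proof -
      let ?y = "x + t *\<^sub>R (y - x)"
      \<comment> \<open>Convexity is given for the epigraph, so the inequality along the segment is
        read off from a convex combination of two of its points.\<close>
      have "(1 - t) *\<^sub>R (x, rx) + t *\<^sub>R (y, ry) \<in> {(x, t). r x \<le> ereal t}"
        using conv that rx ry by (intro convexD) auto
      moreover have "(1 - t) *\<^sub>R x + t *\<^sub>R y = ?y" by (simp add: algebra_simps)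
      ultimately have le: "r ?y \<le> ereal ((1 - t) * rx + t * ry)" by simp
      have "ereal (g x + rx) \<le> ereal (g ?y) + r ?y" using min [of ?y] rx by simp
      also have "\<dots> \<le> ereal (g ?y + ((1 - t) * rx + t * ry))"
        using le by (metis add_left_mono plus_ereal.simps(1))
      finally have "t * (rx - ry) \<le> g ?y - g x" by (simp add: algebra_simps)
      then show ?thesis using that by (simp add: field_simps)
    qed
    have "((\<lambda>t. g (x + t *\<^sub>R (y - x))) has_derivative (\<lambda>t. wip W \<gamma> (t *\<^sub>R (y - x)))) (at 0)"
    proof (rule has_derivative_compose [of "\<lambda>t. x + t *\<^sub>R (y - x)" "\<lambda>t. t *\<^sub>R (y - x)" 0 UNIV g])
      show "((\<lambda>t. x + t *\<^sub>R (y - x)) has_derivative (\<lambda>t. t *\<^sub>R (y - x))) (at 0)"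
        by (auto intro!: derivative_eq_intros)
    qed (use der in simp)
    then have "((\<lambda>t. g (x + t *\<^sub>R (y - x))) has_field_derivative wip W \<gamma> (y - x)) (at 0)"
      unfolding has_field_derivative_def wip_scaleR_right by (simp only: mult_commute_abs)
    then have "((\<lambda>t. (g (x + t *\<^sub>R (y - x)) - g x) / t) \<longlongrightarrow> wip W \<gamma> (y - x)) (at 0)"
      by (simp add: has_field_derivative_iff)
    then have "((\<lambda>t. (g (x + t *\<^sub>R (y - x)) - g x) / t) \<longlongrightarrow> wip W \<gamma> (y - x)) (at_right 0)"
      by (rule tendsto_mono [rotated]) (simp add: at_le)
    moreover have "\<forall>\<^sub>F t in at_right (0::real). rx - ry \<le> (g (x + t *\<^sub>R (y - x)) - g x) / t"
      by (rule eventually_at_rightI [of 0 1]) (use quot in auto)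
    ultimately have "rx - ry \<le> wip W \<gamma> (y - x)"
      by (intro tendsto_lowerbound) auto
    then show ?thesis by (simp add: rx ry wip_linear)
  qed simp
  then show ?thesis using rx by (simp add: subdiff_def)
qed

lemma subdiff_monotone:
  assumes "s \<in> subdiff W r x" and "s' \<in> subdiff W r x'"
  shows "0 \<le> wip W (s - s') (x - x')"
proof -
  obtain rx rx' where r: "r x = ereal rx" "r x' = ereal rx'"
    using assms by (auto simp: subdiff_def)
  have "rx + wip W s (x' - x) \<le> rx'" "rx' + wip W s' (x - x') \<le> rx"
    using assms r unfolding subdiff_def by (simp_all, metis ereal_less_eq(3) plus_ereal.simps(1))+
  then show ?thesis by (simp add: wip_linear)
qed

lemma prox_subgradient:
  assumes sym: "transpose W = W" and "0 < t" and cpc: "closed_proper_convex r"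
    and min: "is_arg_min (\<lambda>y. r y + ereal (1 / (2 * t) * wnorm2 W (y - b))) (\<lambda>_. True) x"
  shows "(1 / t) *\<^sub>R (b - x) \<in> subdiff W r x"
proof -
  let ?g = "\<lambda>y. 1 / (2 * t) * wnorm2 W (y - b)"
  have "(?g has_derivative (\<lambda>v. 1 / (2 * t) * ((x - b) \<bullet> (W *v v) + v \<bullet> (W *v (x - b))))) (at x)"
    unfolding wnorm2_def wip_def
    by (rule derivative_eq_intros bounded_linear.has_derivative [OF matrix_vector_mul_bounded_linear] refl | simp)+
  moreover have "1 / (2 * t) * ((x - b) \<bullet> (W *v v) + v \<bullet> (W *v (x - b)))
      = wip W ((1 / t) *\<^sub>R (x - b)) v" for v
    using wip_commute [OF sym, of v "x - b"] unfolding wip_scaleR_left unfolding wip_def by simp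
  ultimately have "(?g has_derivative (\<lambda>v. wip W ((1 / t) *\<^sub>R (x - b)) v)) (at x)" by simp
  then have "- ((1 / t) *\<^sub>R (x - b)) \<in> subdiff W r x"
    by (rule minimizer_subgradient [OF cpc]) (use min in \<open>auto simp: is_arg_min_def not_less add.commute\<close>)
  moreover have "- ((1 / t) *\<^sub>R (x - b)) = (1 / t) *\<^sub>R (b - x)" by (simp add: algebra_simps)
  ultimately show ?thesis by simp
qed

text \<open>The point \<open>x'\<close> plays the role of the proximal point of
  \<open>x' + t *\<^sub>R s\<close>. Monotonicity of the subdifferential says that \<open>q\<close>
  makes a nonnegative inner product with \<open>x - x'\<close>, so adding \<open>q\<close> cannot
  shorten that difference.\<close>

lemma prox_nonexpansive:
  assumes pd: "pos_def W" and "0 < t" and cpc: "closed_proper_convex r"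
    and min: "is_arg_min (\<lambda>y. r y + ereal (1 / (2 * t) * wnorm2 W (y - b))) (\<lambda>_. True) x"
    and s: "s \<in> subdiff W r x'"
  shows "wnorm2 W (x - x') \<le> wnorm2 W (b - (x' + t *\<^sub>R s))"
proof -
  note sym = pos_def_imp_symmetric [OF pd]
  define q where "q = b - x - t *\<^sub>R s"
  have "0 \<le> wip W ((1 / t) *\<^sub>R (b - x) - s) (x - x')"
    using prox_subgradient [OF sym \<open>0 < t\<close> cpc min] s by (rule subdiff_monotone)
  then have "0 \<le> t * wip W ((1 / t) *\<^sub>R (b - x) - s) (x - x')" using \<open>0 < t\<close> by simp
  also have "\<dots> = wip W q (x - x')"
    using \<open>0 < t\<close> by (simp add: wip_linear q_def field_simps)
  finally have "wnorm2 W (x - x') \<le> wnorm2 W (q + (x - x'))"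
    using pos_def_imp_wnorm2_nonneg [OF pd, of q] by (simp add: wnorm2_add sym)
  also have "q + (x - x') = b - (x' + t *\<^sub>R s)" by (simp add: q_def)
  finally show ?thesis .
qed

section \<open>The network and the penalty term\<close>

lemma avg_weight_bounds: "0 \<le> avg_weight E i j" "avg_weight E i j \<le> 1"
proof -
  let ?X = "\<lambda>T. ereal (1 / real T * (\<Sum>l<T. zeta (E l) {Inl i, Inl j}))"
  have "(\<Sum>l<T. zeta (E l) {Inl i, Inl j}) \<le> (\<Sum>l<T. 1)" for T
    by (rule sum_mono) (simp add: zeta_def indicator_def)
  \<comment> \<open>For \<open>T = 0\<close> the average is 0, because division by zero yields
    0.\<close>
  then have "?X T \<le> 1" for T by (cases "T = 0") (auto simp: field_simps one_ereal_def)
  then have "liminf ?X \<le> 1"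
    by (intro order_trans [OF Liminf_le_Limsup] Limsup_bounded always_eventually) auto
  moreover have "0 \<le> liminf ?X"
    by (intro Liminf_bounded always_eventually) (auto simp: zeta_def intro!: divide_nonneg_nonneg sum_nonneg)
  ultimately show "0 \<le> avg_weight E i j" "avg_weight E i j \<le> 1"
    unfolding avg_weight_def by (cases "liminf ?X"; auto simp: one_ereal_def)+
qed

lemma avg_weight_pos_imp_edge:
  assumes "0 < avg_weight E i j"
  shows "\<exists>k. {Inl i, Inl j} \<in> E k"
proof (rule ccontr)
  assume "\<not> ?thesis"
  then have "avg_weight E i j = 0" by (simp add: avg_weight_def zeta_def Liminf_const)
  with assms show False by simp
qed

text \<open>A nonzero matrix makes the set of positive singular values nonempty, so its
  \<open>Min\<close> is one of them. An eigenvector for it and Cauchy-Schwarz on each row of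
  \<open>A\<close> bound it by the Frobenius norm.\<close>

lemma min_nonzero_singular_value_bounds:
  fixes A :: "real^'m^'k"
  assumes "A \<noteq> 0"
  shows "0 < min_nonzero_singular_value A"
    and "(min_nonzero_singular_value A)\<^sup>2 \<le> (\<Sum>i\<in>UNIV. \<Sum>j\<in>UNIV. (A $ i $ j)\<^sup>2)"
proof -
  let ?T = "transpose A ** A" and ?s = "min_nonzero_singular_value A"
  let ?S = "{s. 0 < s \<and> s\<^sup>2 \<in> eigenvalues ?T}"
  have sym: "transpose ?T = ?T" by (simp add: matrix_transpose_mul)
  have w: "wnorm2 ?T x = (norm (A *v x))\<^sup>2" for x
    by (simp add: wnorm2_def wip_def matrix_vector_mul_assoc [symmetric] power2_norm_eq_inner
        dot_lmul_matrix [symmetric] transpose_matrix_vector inner_commute)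
  have "?S \<subseteq> sqrt ` eigenvalues ?T" by (auto intro!: image_eqI [of _ _ "_\<^sup>2"])
  then have fin: "finite ?S" by (rule finite_subset) (simp add: finite_eigenvalues_symmetric [OF sym])
  obtain x where "A *v x \<noteq> 0" using assms by (metis matrix_eq matrix_vector_mult_0)
  then have "0 < (norm (A *v x))\<^sup>2" by simp
  also have "\<dots> \<le> lambda_max ?T * (norm x)\<^sup>2" using le_lambda_max [OF sym, of x] by (simp add: w)
  finally have "0 < lambda_max ?T * (norm x)\<^sup>2" .
  then have "0 < lambda_max ?T" by (simp add: zero_less_mult_iff)
  then have "sqrt (lambda_max ?T) \<in> ?S" using lambda_max_in_eigenvalues [OF sym] by simp
  then have "?s \<in> ?S" unfolding min_nonzero_singular_value_def using fin by (intro Min_in) blast+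
  then show "0 < ?s" by simp
  obtain v where v: "v \<noteq> 0" "?T *v v = ?s\<^sup>2 *\<^sub>R v"
    using \<open>?s \<in> ?S\<close> by (auto simp: eigenvalues_def)
  have row: "(norm (A $ i))\<^sup>2 = (\<Sum>j\<in>UNIV. (A $ i $ j)\<^sup>2)" for i
    unfolding power2_norm_eq_inner inner_vec_def by (simp add: power2_eq_square)
  have "?s\<^sup>2 * (norm v)\<^sup>2 = (norm (A *v v))\<^sup>2"
    using eigenvalue_eq_quotient [OF v(2)] w by simp
  also have "\<dots> = (\<Sum>i\<in>UNIV. (A $ i \<bullet> v)\<^sup>2)"
    unfolding power2_norm_eq_inner inner_vec_def [of "A *v v"]
    by (simp add: matrix_vector_mul_component power2_eq_square)
  also have "\<dots> \<le> (\<Sum>i\<in>UNIV. (norm (A $ i))\<^sup>2 * (norm v)\<^sup>2)"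
    by (intro sum_mono) (metis Cauchy_Schwarz_ineq2 abs_ge_zero power2_abs power_mono power_mult_distrib)
  finally show "?s\<^sup>2 \<le> (\<Sum>i\<in>UNIV. \<Sum>j\<in>UNIV. (A $ i $ j)\<^sup>2)"
    using v(1) by (simp add: row sum_distrib_right [symmetric])
qed

text \<open>A column of an edge has two nonzero entries of modulus at most 1, so the squared
  Frobenius norm is at most twice the number of edges.\<close>

lemma incidence_singular_value:
  fixes E :: "nat \<Rightarrow> ('r::{finite,linorder} + 'b) set set"
  assumes "avg_edges E \<noteq> {}"
  shows "0 < min_nonzero_singular_value (incidence E)"
    and "min_nonzero_singular_value (incidence E) \<le> sqrt 2 * sqrt (real (card (avg_edges E)))"
proof -
  obtain i j where ij: "(i, j) \<in> avg_edges E" using assms by auto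
  then have "incidence E $ i $ (i, j) \<noteq> 0" by (simp add: incidence_def avg_edges_def)
  then have "incidence E \<noteq> 0" by auto
  note s = min_nonzero_singular_value_bounds [OF this]
  show "0 < min_nonzero_singular_value (incidence E)" by (rule s)
  have col: "(\<Sum>v\<in>UNIV. (incidence E $ v $ e)\<^sup>2) \<le> (if e \<in> avg_edges E then 2 else 0)" for e
  proof (cases "e \<in> avg_edges E")
    case True
    have sq: "(avg_weight E p q)\<^sup>2 \<le> 1" for p q
      using avg_weight_bounds [of E p q] by (simp add: abs_square_le_1)
    have "(\<Sum>v\<in>UNIV. (incidence E $ v $ e)\<^sup>2)
        \<le> (\<Sum>v\<in>UNIV. (if v = fst e then 1 else 0) + (if v = snd e then 1 else 0))"
      using order_trans [OF sq, of 2] by (intro sum_mono) (auto simp: incidence_def sq)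
    also have "\<dots> = 2" by (simp add: sum.distrib)
    finally show ?thesis using True by simp
  qed (simp add: incidence_def)
  have "(min_nonzero_singular_value (incidence E))\<^sup>2 \<le> (\<Sum>v\<in>UNIV. \<Sum>e\<in>UNIV. (incidence E $ v $ e)\<^sup>2)"
    by (rule s)
  also have "\<dots> = (\<Sum>e\<in>UNIV. \<Sum>v\<in>UNIV. (incidence E $ v $ e)\<^sup>2)" by (rule sum.swap)
  also have "\<dots> \<le> (\<Sum>e\<in>UNIV. if e \<in> avg_edges E then 2 else 0)" by (intro sum_mono col)
  also have "\<dots> = 2 * real (card (avg_edges E))" by (simp add: sum.If_cases)
  finally show "min_nonzero_singular_value (incidence E) \<le> sqrt 2 * sqrt (real (card (avg_edges E)))"
    by (metis real_le_rsqrt real_sqrt_mult)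
qed

text \<open>The root of the edge count in the penalty factor cancels the one in the bound on the
  singular value. What remains is the comparison of \<open>sqrt 2\<close> with the power 3/2 of the
  number of agents, and an edge provides two agents. Hence the penalty parameter dominates the
  maximum of \<open>infnorm (G i xs + rs i)\<close>.\<close>

lemma penalty_factor_ge_1:
  fixes E :: "nat \<Rightarrow> ('r::{finite,linorder} + 'b) set set"
  assumes "avg_edges E \<noteq> {}"
  shows "1 \<le> real CARD('r) powr (3 / 2) * sqrt (real (card (avg_edges E)))
           / min_nonzero_singular_value (incidence E)"
proof -
  obtain i j :: 'r where "i < j" using assms by (auto simp: avg_edges_def)
  then have "card {i, j} = 2" by auto
  moreover have "card {i, j} \<le> CARD('r)" by (rule card_mono) auto
  ultimately have "2 powr (1 / 2) \<le> real CARD('r) powr (3 / 2)"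
    by (intro order_trans [OF powr_mono [of "1/2" "3/2" 2] powr_mono2]) auto
  then have "sqrt 2 * sqrt (real (card (avg_edges E)))
      \<le> real CARD('r) powr (3 / 2) * sqrt (real (card (avg_edges E)))"
    by (intro mult_right_mono) (simp_all add: powr_half_sqrt)
  then show ?thesis using incidence_singular_value [OF assms] by simp
qed

text \<open>The first edge of a path from \<open>i\<close> to \<open>j\<close> has positive average
  weight, so it is present at some iteration. Having at least one reliable neighbour allows the
  residual at \<open>xs\<close> to be charged to the neighbour count.\<close>

lemma connected_imp_reliable_neighbour:
  fixes E :: "nat \<Rightarrow> ('r::{finite,linorder} + 'b) set set"
  assumes "sufficient_connectivity E" and "i \<noteq> j"
  shows "avg_edges E \<noteq> {}" and "1 \<le> card (all_reliable_neighbours E i)"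
proof -
  have "(i, j) \<in> (avg_edges E \<union> (avg_edges E)\<inverse>)\<^sup>*"
    using assms(1) by (simp add: sufficient_connectivity_def)
  then obtain k where k: "(i, k) \<in> avg_edges E \<union> (avg_edges E)\<inverse>"
    using \<open>i \<noteq> j\<close> by (metis converse_rtranclE)
  then show "avg_edges E \<noteq> {}" by auto
  have "\<exists>l. {Inl i, Inl k} \<in> E l"
    using k avg_weight_pos_imp_edge [of E i k] avg_weight_pos_imp_edge [of E k i]
    by (auto simp: avg_edges_def insert_commute)
  then have "k \<in> all_reliable_neighbours E i"
    by (auto simp: all_reliable_neighbours_def neighbours_def)
  then show "1 \<le> card (all_reliable_neighbours E i)"
    using card_gt_0_iff [of "all_reliable_neighbours E i"] by (auto simp: Suc_le_eq)
qed

text \<open>The type of Byzantine agents may be infinite; finiteness comes from the edges lying in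
  \<open>agent_pairs B\<close>. The count is uniform in \<open>k\<close> because it includes every
  agent that is ever a neighbour.\<close>

lemma neighbours_bound:
  fixes E :: "nat \<Rightarrow> ('r::finite + 'b) set set"
  assumes "finite B" and "\<And>k. E k \<subseteq> agent_pairs B"
  shows "finite (neighbours (E k) i)"
    and "card (neighbours (E k) i) \<le> card (all_reliable_neighbours E i) + card (all_byzantine_neighbours E i)"
proof -
  have "b \<in> B" if "{Inl i, Inr b} \<in> E k" for b k
  proof -
    have "{Inl i, Inr b} \<in> (agent_pairs B :: ('r + 'b) set set)" using that assms(2) by blast
    then have "Inr b \<in> (UNIV :: 'r set) <+> B"
      unfolding agent_pairs_def by (smt (verit) insertCI insertE mem_Collect_eq singletonD)
    then show ?thesis by auto
  qed
  then have "all_byzantine_neighbours E i \<subseteq> B"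
    by (auto simp: all_byzantine_neighbours_def neighbours_def)
  then have fin: "finite (all_byzantine_neighbours E i)" using \<open>finite B\<close> finite_subset by blast
  have sub: "neighbours (E k) i
      \<subseteq> all_reliable_neighbours E i <+> all_byzantine_neighbours E i"
  proof
    fix j assume "j \<in> neighbours (E k) i"
    then show "j \<in> all_reliable_neighbours E i <+> all_byzantine_neighbours E i"
      by (cases j) (auto simp: all_reliable_neighbours_def all_byzantine_neighbours_def)
  qed
  then show "finite (neighbours (E k) i)" using fin by (meson finite finite_Plus finite_subset)
  show "card (neighbours (E k) i) \<le> card (all_reliable_neighbours E i) + card (all_byzantine_neighbours E i)"
    using card_mono [OF _ sub] fin by (simp add: card_Plus)
qed

text \<open>Only the single-agent case needs optimality of \<open>xs\<close>: the penalty bound is then void, but the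
  minimizer has \<open>- G i xs\<close> as a subgradient. Otherwise the penalty bound alone makes \<open>G i xs + rs i\<close>
  small, whatever the chosen subgradient is.\<close>

lemma reference_subgradient:
  fixes E :: "nat \<Rightarrow> ('r::{finite,linorder} + 'b) set set" and G :: "'r \<Rightarrow> real^'n \<Rightarrow> real^'n"
  assumes conn: "sufficient_connectivity E"
    and grad: "\<And>i. is_W_gradient (W i) (f i) (G i)"
    and cpc: "\<And>i. closed_proper_convex (r i)"
    and opt: "is_arg_min (\<lambda>y. \<Sum>i\<in>UNIV. ereal (f i y) + r i y) (\<lambda>_. True) xs"
    and rs: "\<And>i. rs i \<in> subdiff (W i) (r i) xs"
    and ph: "ph \<ge> real CARD('r) powr (3 / 2) * sqrt (real (card (avg_edges E)))
           / min_nonzero_singular_value (incidence E)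
           * Max (range (\<lambda>i. infnorm (G i xs + rs i)))"
  shows "0 \<le> ph"
    and "\<exists>s. s \<in> subdiff (W i) (r i) xs \<and>
      norm (G i xs + s) \<le> ph * sqrt (real CARD('n)) * real (card (all_reliable_neighbours E i))"
proof -
  let ?c = "real CARD('r) powr (3 / 2) * sqrt (real (card (avg_edges E)))
           / min_nonzero_singular_value (incidence E)"
  let ?m = "Max (range (\<lambda>i. infnorm (G i xs + rs i)))"
  have m: "infnorm (G i xs + rs i) \<le> ?m" for i by simp
  then have m0: "0 \<le> ?m" using infnorm_pos_le order_trans by blast
  show ph0: "0 \<le> ph"
  \<comment> \<open>Without edges the factor under the root is 0, so the penalty condition itself
    reads \<open>0 \<le> ph\<close>. With edges, the factor is at least 1.\<close>
  proof (cases "avg_edges E = {}")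
    case False
    then have "0 \<le> ?c * ?m" using penalty_factor_ge_1 m0 by (intro mult_nonneg_nonneg) fastforce+
    then show ?thesis using ph by linarith
  qed (use ph in simp)
  show "\<exists>s. s \<in> subdiff (W i) (r i) xs \<and>
      norm (G i xs + s) \<le> ph * sqrt (real CARD('n)) * real (card (all_reliable_neighbours E i))"
  proof (cases "\<exists>j. i \<noteq> j")
    case True
    then obtain j where "i \<noteq> j" by blast
    note nb = connected_imp_reliable_neighbour [OF conn this]
    have "?m \<le> ?c * ?m" using mult_right_mono [OF penalty_factor_ge_1 [OF nb(1)] m0] by (simp only: mult_1)
    then have "infnorm (G i xs + rs i) \<le> ph" using ph m [of i] by linarith
    then have "norm (G i xs + rs i) \<le> sqrt (real CARD('n)) * ph"
      using norm_le_infnorm [of "G i xs + rs i"]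
      by (simp add: order_trans mult_left_mono)
    also have "\<dots> \<le> ph * sqrt (real CARD('n)) * real (card (all_reliable_neighbours E i))"
      using mult_left_mono [of 1 "real (card (all_reliable_neighbours E i))" "ph * sqrt (real CARD('n))"]
        nb(2) ph0 by (simp add: mult.commute)
    finally show ?thesis using rs by blast
  next
    case False
    then have U: "UNIV = {i}" by auto
    have "- G i xs \<in> subdiff (W i) (r i) xs"
    proof (rule minimizer_subgradient [OF cpc])
      show "(f i has_derivative wip (W i) (G i xs)) (at xs)"
        using grad [of i] by (simp add: is_W_gradient_def)
      show "ereal (f i xs) + r i xs \<le> ereal (f i y) + r i y" for y
        using opt unfolding U by (auto simp: is_arg_min_def not_less)
    qed
    then show ?thesis using ph0 by (intro exI [of _ "- G i xs"]) simp
  qed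
qed

text \<open>The neighbours contribute \<open>R + C\<close> and the residual \<open>v\<close>
  contributes another \<open>R\<close>. The estimate of (2R + C)^2 by 2(4R^2 + C^2) is the origin of
  the weights 4 and 1 in \<open>neighbour_weight\<close>.\<close>

lemma penalty_noise_bound:
  fixes s :: "'j \<Rightarrow> real^'n"
  assumes sym: "transpose W = W" and nonneg: "0 \<le> lambda_max W" and "0 \<le> ph"
    and s: "\<And>j. j \<in> J \<Longrightarrow> norm (s j) \<le> sqrt (real CARD('n))"
    and v: "norm v \<le> ph * sqrt (real CARD('n)) * R"
    and J: "real (card J) \<le> R + C"
  shows "wnorm2 W (ph *\<^sub>R (\<Sum>j\<in>J. s j) + v) \<le> 2 * real CARD('n) * ph\<^sup>2 * ((4 * R\<^sup>2 + C\<^sup>2) * lambda_max W)"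
proof -
  let ?p = "ph *\<^sub>R (\<Sum>j\<in>J. s j) + v"
  have "norm (\<Sum>j\<in>J. s j) \<le> real (card J) * sqrt (real CARD('n))"
    by (rule sum_norm_bound) (rule s)
  also have "\<dots> \<le> (R + C) * sqrt (real CARD('n))" using J by (simp add: mult_right_mono)
  finally have "norm (ph *\<^sub>R (\<Sum>j\<in>J. s j)) \<le> ph * ((R + C) * sqrt (real CARD('n)))"
    using \<open>0 \<le> ph\<close> by (simp add: mult_left_mono)
  then have "norm ?p \<le> ph * sqrt (real CARD('n)) * (2 * R + C)"
    using norm_triangle_ineq [of "ph *\<^sub>R (\<Sum>j\<in>J. s j)" v] v by (simp add: algebra_simps)
  then have "(norm ?p)\<^sup>2 \<le> (ph * sqrt (real CARD('n)) * (2 * R + C))\<^sup>2"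
    by (rule power_mono) simp
  also have "\<dots> = ph\<^sup>2 * real CARD('n) * (2 * R + C)\<^sup>2" by (simp add: power_mult_distrib)
  also have "\<dots> \<le> ph\<^sup>2 * real CARD('n) * (2 * (4 * R\<^sup>2 + C\<^sup>2))"
  proof (rule mult_left_mono)
    show "(2 * R + C)\<^sup>2 \<le> 2 * (4 * R\<^sup>2 + C\<^sup>2)"
      using zero_le_power2 [of "2 * R - C"] by (simp add: power2_eq_square algebra_simps)
  qed simp
  finally have "lambda_max W * (norm ?p)\<^sup>2 \<le> lambda_max W * (ph\<^sup>2 * real CARD('n) * (2 * (4 * R\<^sup>2 + C\<^sup>2)))"
    using nonneg by (rule mult_left_mono)
  with le_lambda_max [OF sym, of ?p] show ?thesis by (simp add: algebra_simps)
qed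

section \<open>Expectations of sketched quadratic forms\<close>

lemma bounded_linear_wip_matrix: "bounded_linear (\<lambda>A :: real^'n^'n. wip A x y)"
  unfolding wip_eq_sum
  by (intro bounded_linear_sum bounded_linear_mult_const bounded_linear_compose [OF bounded_linear_vec_nth]
      bounded_linear_vec_nth)

lemma integral_wip:
  fixes K :: "'s \<Rightarrow> real^'n^'n"
  assumes "integrable D K"
  shows "wip (\<integral>s. K s \<partial>D) x y = (\<integral>s. wip (K s) x y \<partial>D)" and "integrable D (\<lambda>s. wip (K s) x y)"
  using integral_bounded_linear [OF bounded_linear_wip_matrix assms, of x y]
    integrable_bounded_linear [OF bounded_linear_wip_matrix assms, of x y] by simp_all

lemma transpose_integral:
  fixes K :: "'s \<Rightarrow> real^'n^'n"
  assumes "integrable D K" and "\<And>s. transpose (K s) = K s"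
  shows "transpose (\<integral>s. K s \<partial>D) = (\<integral>s. K s \<partial>D)"
  unfolding vec_eq_iff transpose_def
  by (simp add: wip_axis [symmetric] integral_wip(1) [OF assms(1)] wip_commute [OF assms(2)])

text \<open>The last two claims order the matrices as M, W, Phi; they are later needed for
  \<open>gam * al \<le> 1\<close>. Both come from nonnegativity of \<open>sketch_residual\<close>;
  for the second, the mean of theta K being \<open>W\<close> turns the averaged residual into Phi -
  W.\<close>

lemma sketch_means:
  fixes W :: "real^'n^'n" and D :: "(real^'p^'n) measure"
  assumes law: "sketch_law W D th" and pd: "pos_def W"
  shows "transpose (sketch_mean W D) = sketch_mean W D"
    and "transpose (sketch_second W D th) = sketch_second W D th"
    and "0 \<le> wnorm2 (sketch_mean W D) v"
    and "0 \<le> wnorm2 (sketch_second W D th) v"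
    and "wnorm2 (sketch_mean W D) v \<le> wnorm2 W v"
    and "wnorm2 W v \<le> wnorm2 (sketch_second W D th) v"
proof -
  interpret prob_space D using law by (simp add: sketch_law_def)
  let ?K = "sketch_mat W"
  have int: "integrable D ?K" "integrable D (\<lambda>S. th S *\<^sub>R ?K S)"
    "integrable D (\<lambda>S. (th S)\<^sup>2 *\<^sub>R ?K S)" and mean: "(\<integral>S. th S *\<^sub>R ?K S \<partial>D) = W"
    using law by (simp_all add: sketch_law_def)
  have sym: "transpose (t *\<^sub>R ?K S) = t *\<^sub>R ?K S" for t S
    using sketch_mat_props(1) [OF pd, of S] by (simp add: transpose_def vec_eq_iff)
  show "transpose (sketch_mean W D) = sketch_mean W D"
    unfolding sketch_mean_def using int(1) sketch_mat_props(1) [OF pd] by (rule transpose_integral)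
  show "transpose (sketch_second W D th) = sketch_second W D th"
    unfolding sketch_second_def using int(3) sym by (rule transpose_integral)
  have K0: "0 \<le> wnorm2 (?K S) v" for S by (rule sketch_mat_wnorm2_nonneg [OF pd])
  have M: "wnorm2 (sketch_mean W D) v = (\<integral>S. wnorm2 (?K S) v \<partial>D)"
    by (simp add: sketch_mean_def wnorm2_def integral_wip(1) [OF int(1)])
  have P: "wnorm2 (sketch_second W D th) v = (\<integral>S. (th S)\<^sup>2 * wnorm2 (?K S) v \<partial>D)"
    by (simp add: sketch_second_def wnorm2_def integral_wip(1) [OF int(3)] wip_matrix_scaleR)
  have Wm: "wnorm2 W v = (\<integral>S. th S * wnorm2 (?K S) v \<partial>D)"
    using integral_wip(1) [OF int(2), of v v] by (simp add: mean wnorm2_def wip_matrix_scaleR)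
  have int': "integrable D (\<lambda>S. wnorm2 (?K S) v)" "integrable D (\<lambda>S. th S * wnorm2 (?K S) v)"
    "integrable D (\<lambda>S. (th S)\<^sup>2 * wnorm2 (?K S) v)"
    using integral_wip(2) [OF int(1), of v v] integral_wip(2) [OF int(2), of v v]
      integral_wip(2) [OF int(3), of v v] by (simp_all add: wnorm2_def wip_matrix_scaleR)
  show "0 \<le> wnorm2 (sketch_mean W D) v" unfolding M using K0 by (intro Bochner_Integration.integral_nonneg)
  show "0 \<le> wnorm2 (sketch_second W D th) v" unfolding P by (intro Bochner_Integration.integral_nonneg mult_nonneg_nonneg K0) simp
  have res: "0 \<le> wnorm2 W v - 2 * t * wnorm2 (?K S) v + t\<^sup>2 * wnorm2 (?K S) v" for t S
    using pos_def_imp_wnorm2_nonneg [OF pd] by (simp flip: sketch_residual [OF pd])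
  have "(\<integral>S. wnorm2 (?K S) v \<partial>D) \<le> (\<integral>S. wnorm2 W v \<partial>D)"
  proof (rule integral_mono)
    show "wnorm2 (?K S) v \<le> wnorm2 W v" for S using res [of 1 S] by simp
  qed (simp_all add: int'(1))
  then show "wnorm2 (sketch_mean W D) v \<le> wnorm2 W v" by (simp add: M prob_space)
  have "0 \<le> (\<integral>S. wnorm2 W v - 2 * (th S * wnorm2 (?K S) v) + (th S)\<^sup>2 * wnorm2 (?K S) v \<partial>D)"
    using res by (intro Bochner_Integration.integral_nonneg) (simp add: mult.assoc)
  also have "\<dots> = wnorm2 W v - 2 * wnorm2 W v + wnorm2 (sketch_second W D th) v"
    using int' by (simp add: Wm [symmetric] P prob_space)
  finally show "wnorm2 W v \<le> wnorm2 (sketch_second W D th) v" by simp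
qed

section \<open>Measurability and integrability of quadratic forms, and averaging over an independent
  sketch\<close>

lemma borel_measurable_wip [measurable (raw)]:
  fixes u v :: "'a \<Rightarrow> real^'n"
  assumes [measurable]: "u \<in> borel_measurable M" "v \<in> borel_measurable M"
  shows "(\<lambda>w. wip A (u w) (v w)) \<in> borel_measurable M"
proof -
  have *: "(\<lambda>w. A *v v w) \<in> borel_measurable M"
    by (rule borel_measurable_continuous_on [OF _ assms(2)]) (intro continuous_intros)
  show ?thesis unfolding wip_def using * by measurable
qed

lemma borel_measurable_wnorm2 [measurable (raw)]:
  fixes u :: "'a \<Rightarrow> real^'n"
  shows "u \<in> borel_measurable M \<Longrightarrow> (\<lambda>w. wnorm2 A (u w)) \<in> borel_measurable M"
  unfolding wnorm2_def by measurable

lemma integrable_component_mult: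
  fixes u v :: "'a \<Rightarrow> real^'n"
  assumes [measurable]: "u \<in> borel_measurable M" "v \<in> borel_measurable M"
    and "integrable M (\<lambda>w. (norm (u w))\<^sup>2)" "integrable M (\<lambda>w. (norm (v w))\<^sup>2)"
  shows "integrable M (\<lambda>w. u w $ a * v w $ b)"
proof (rule Bochner_Integration.integrable_bound)
  show "integrable M (\<lambda>w. (norm (u w))\<^sup>2 + (norm (v w))\<^sup>2)" using assms by simp
  show "(\<lambda>w. u w $ a * v w $ b) \<in> borel_measurable M"
    by (intro borel_measurable_times borel_measurable_continuous_on [OF _ assms(1), of "\<lambda>x. x $ a"]
        borel_measurable_continuous_on [OF _ assms(2), of "\<lambda>x. x $ b"] continuous_intros)
  have "\<bar>x $ a * y $ b\<bar> \<le> \<bar>(norm x)\<^sup>2 + (norm y)\<^sup>2\<bar>" for x y :: "real^'n"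
  proof -
    have "\<bar>x $ a * y $ b\<bar> \<le> norm x * norm y"
      unfolding abs_mult by (intro mult_mono component_le_norm_cart) auto
    also have "\<dots> \<le> (norm x)\<^sup>2 + (norm y)\<^sup>2"
      using sum_squares_bound [of "norm x" "norm y"] mult_nonneg_nonneg [OF norm_ge_zero norm_ge_zero, of x y] by linarith
    finally show ?thesis by simp
  qed
  then show "AE w in M. norm (u w $ a * v w $ b) \<le> norm ((norm (u w))\<^sup>2 + (norm (v w))\<^sup>2)" by simp
qed

lemma integrable_wip:
  fixes u v :: "'a \<Rightarrow> real^'n"
  assumes "u \<in> borel_measurable M" "v \<in> borel_measurable M"
    and "integrable M (\<lambda>w. (norm (u w))\<^sup>2)" "integrable M (\<lambda>w. (norm (v w))\<^sup>2)"
  shows "integrable M (\<lambda>w. wip A (u w) (v w))"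
  unfolding wip_eq_sum using integrable_component_mult [OF assms] by simp

context prob_space
begin

text \<open>In the expansion into entries, each summand is an entry of \<open>K (S w)\<close> times
  a product of coordinates of \<open>u\<close> and \<open>v\<close>. The first is a function of the
  sketch and the second is known before it, so the two real variables are independent and their
  expectations multiply. Integrability of \<open>K\<close> and square integrability of the vectors
  suffice for every factor.\<close>

lemma expectation_wip_indep:
  fixes K :: "real^'p^'n \<Rightarrow> real^'n^'n" and u v :: "'a \<Rightarrow> real^'n"
  assumes ind: "indep_set (sets (vimage_algebra (space M) S borel)) (sets F)"
    and F: "subalgebra M F"
    and S: "S \<in> borel_measurable M" "distr M borel S = D"
    and K: "integrable D K"
    and uv: "u \<in> borel_measurable F" "v \<in> borel_measurable F"
    and sq: "integrable M (\<lambda>w. (norm (u w))\<^sup>2)" "integrable M (\<lambda>w. (norm (v w))\<^sup>2)"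
  shows "integrable M (\<lambda>w. wip (K (S w)) (u w) (v w))"
    and "(\<integral>w. wip (K (S w)) (u w) (v w) \<partial>M) = (\<integral>w. wip (\<integral>s. K s \<partial>D) (u w) (v w) \<partial>M)"
proof -
  note uvM = uv [THEN measurable_from_subalg [OF F]]
  note intY = integrable_component_mult [OF uvM sq]
  have KD: "K \<in> borel_measurable borel"
    using K S(2) by (metis borel_measurable_integrable measurable_distr_eq1)
  have Kab: "(\<lambda>s. K s $ a $ b) \<in> borel_measurable borel" for a b
    by (rule borel_measurable_continuous_on [OF _ KD]) (intro continuous_intros)
  have KabD: "integrable D (\<lambda>s. K s $ a $ b)" "(\<integral>s. K s \<partial>D) $ a $ b = (\<integral>s. K s $ a $ b \<partial>D)" for a b
    using integral_wip [OF K, of "axis a 1" "axis b 1"] by (simp_all add: wip_axis)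
  have ints: "integrable M (\<lambda>w. K (S w) $ a $ b * (u w $ a * v w $ b)) \<and>
      (\<integral>w. K (S w) $ a $ b * (u w $ a * v w $ b) \<partial>M)
      = (\<integral>s. K s \<partial>D) $ a $ b * (\<integral>w. u w $ a * v w $ b \<partial>M)" for a b
  proof -
    let ?X = "\<lambda>w. K (S w) $ a $ b" and ?Y = "\<lambda>w. u w $ a * v w $ b"
    have YF: "?Y \<in> borel_measurable F"
      by (intro borel_measurable_times borel_measurable_continuous_on [OF _ uv(1), of "\<lambda>x. x $ a"]
        borel_measurable_continuous_on [OF _ uv(2), of "\<lambda>x. x $ b"] continuous_intros)
    have "S \<in> borel_measurable (vimage_algebra (space M) S borel)"
      by (rule measurable_vimage_algebra1) simp
    then have XV: "?X \<in> borel_measurable (vimage_algebra (space M) S borel)"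
      using Kab by (rule measurable_compose)
    have "indep_var borel ?X borel ?Y"
      unfolding indep_var_eq
    proof (intro conjI)
      show "random_variable borel ?X" using S(1) Kab by (rule measurable_compose)
      show "random_variable borel ?Y" by (rule measurable_from_subalg [OF F YF])
      have "sigma_sets (space M) {?X -` A \<inter> space M |A. A \<in> sets borel}
          \<subseteq> sets (vimage_algebra (space M) S borel)"
        using measurable_sets [OF XV] sets.sigma_sets_subset
          [of "{?X -` A \<inter> space M |A. A \<in> sets borel}" "vimage_algebra (space M) S borel"] by auto
      moreover have "sigma_sets (space M) {?Y -` A \<inter> space M |A. A \<in> sets borel} \<subseteq> sets F"
        using measurable_sets [OF YF] F sets.sigma_sets_subset
          [of "{?Y -` A \<inter> space M |A. A \<in> sets borel}" F] by (auto simp: subalgebra_def)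
      ultimately show "indep_set (sigma_sets (space M) {?X -` A \<inter> space M |A. A \<in> sets borel})
          (sigma_sets (space M) {?Y -` A \<inter> space M |A. A \<in> sets borel})"
        using ind unfolding indep_sets2_eq by blast
    qed
    moreover have "integrable M ?X"
      using KabD(1) [of a b] unfolding S(2) [symmetric] by (rule integrable_distr [OF S(1)])
    moreover have "(\<integral>w. ?X w \<partial>M) = (\<integral>s. K s \<partial>D) $ a $ b"
      unfolding KabD(2) using integral_distr [OF S(1) Kab, of a b] by (simp add: S(2))
    ultimately show ?thesis
      using indep_var_lebesgue_integral [of ?X ?Y] indep_var_integrable [of ?X ?Y] intY by simp
  qed
  then show "integrable M (\<lambda>w. wip (K (S w)) (u w) (v w))"
    unfolding wip_eq_sum by simp
  show "(\<integral>w. wip (K (S w)) (u w) (v w) \<partial>M) = (\<integral>w. wip (\<integral>s. K s \<partial>D) (u w) (v w) \<partial>M)"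
    unfolding wip_eq_sum using ints intY by simp
qed

end

section \<open>Measurability of the proximal iterate\<close>

lemma wnorm2_lipschitz:
  fixes W :: "real^'n^'n"
  assumes pd: "pos_def W" and le: "wnorm2 W x \<le> wnorm2 W y"
  shows "norm x \<le> sqrt (lambda_max W / lambda_min W) * norm y"
proof -
  note sym = pos_def_imp_symmetric [OF pd]
  define q where "q = lambda_max W / lambda_min W"
  have "lambda_min W * (norm x)\<^sup>2 \<le> lambda_max W * (norm y)\<^sup>2"
    using order_trans [OF lambda_min_le [OF sym, of x] order_trans [OF le le_lambda_max [OF sym, of y]]] .
  moreover have "lambda_max W = lambda_min W * q"
    using lambda_min_pos_def [OF pd] by (simp add: q_def)
  ultimately have "lambda_min W * (norm x)\<^sup>2 \<le> lambda_min W * (q * (norm y)\<^sup>2)"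
    by (simp only: mult.assoc)
  then have "(norm x)\<^sup>2 \<le> q * (norm y)\<^sup>2"
    using lambda_min_pos_def [OF pd] by (rule mult_left_le_imp_le)
  then have "norm x \<le> sqrt (q * (norm y)\<^sup>2)" by (rule real_le_rsqrt)
  also have "\<dots> = sqrt q * norm y" by (simp add: real_sqrt_mult)
  finally show ?thesis unfolding q_def .
qed

text \<open>The proximal point is a Lipschitz function of its input on the range of the input, which
  extends continuously to the closure of that range. So no existence theorem for proximal points
  is needed.\<close>

lemma prox_measurable:
  fixes W :: "real^'n^'n"
  assumes pd: "pos_def W" and "0 < t" and cpc: "closed_proper_convex r"
    and b: "b \<in> borel_measurable M"
    and min: "\<And>w. w \<in> space M \<Longrightarrow>
      is_arg_min (\<lambda>y. r y + ereal (1 / (2 * t) * wnorm2 W (y - b w))) (\<lambda>_. True) (x w)"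
  shows "x \<in> borel_measurable M"
proof -
  let ?B = "b ` space M" and ?L = "sqrt (lambda_max W / lambda_min W)"
  have lip: "norm (x w - x w') \<le> ?L * norm (b w - b w')" if "w \<in> space M" "w' \<in> space M" for w w'
  proof (rule wnorm2_lipschitz [OF pd])
    have "(1 / t) *\<^sub>R (b w' - x w') \<in> subdiff W r (x w')"
      using min [OF that(2)] by (rule prox_subgradient [OF pos_def_imp_symmetric [OF pd] \<open>0 < t\<close> cpc])
    from prox_nonexpansive [OF pd \<open>0 < t\<close> cpc min [OF that(1)] this]
    show "wnorm2 W (x w - x w') \<le> wnorm2 W (b w - b w')" using \<open>0 < t\<close> by simp
  qed
  \<comment> \<open>The choice of \<open>w\<close> does not matter: by \<open>lip\<close>, outcomes
    with equal input have equal proximal points.\<close>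
  define p where "p y = x (SOME w. w \<in> space M \<and> b w = y)" for y
  have p: "p (b w) = x w" if "w \<in> space M" for w
  proof -
    define v where "v = (SOME w'. w' \<in> space M \<and> b w' = b w)"
    have v: "v \<in> space M \<and> b v = b w" unfolding v_def by (rule someI [of _ w]) (use that in simp)
    then have "norm (x v - x w) \<le> 0" using lip [of v w] that by simp
    then show ?thesis unfolding p_def v_def [symmetric] by simp
  qed
  have "dist (p y) (p y') \<le> max 0 ?L * dist y y'" if y: "y \<in> ?B" "y' \<in> ?B" for y y'
  proof -
    obtain w w' where "w \<in> space M" "w' \<in> space M" "y = b w" "y' = b w'" using y by blast
    then have "dist (p y) (p y') \<le> ?L * dist y y'" using lip by (simp add: p dist_norm)
    also have "\<dots> \<le> max 0 ?L * dist y y'" by (intro mult_right_mono) auto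
    finally show ?thesis .
  qed
  then have "(max 0 ?L)-lipschitz_on ?B p" by (intro lipschitz_onI) auto
  then have uc: "uniformly_continuous_on ?B p" by (rule lipschitz_on_uniformly_continuous)
  obtain g where g: "uniformly_continuous_on (closure ?B) g" "\<And>y. y \<in> ?B \<Longrightarrow> p y = g y"
    by (rule uniformly_continuous_on_extension_on_closure [OF uc], rule that)
  \<comment> \<open>The extension is continuous only on a closed set. Multiplying by the indicator
    of that set gives a Borel function on the whole space that agrees with \<open>p\<close> on the
    range of \<open>b\<close>.\<close>
  have "(\<lambda>y. indicator (closure ?B) y *\<^sub>R g y) \<in> borel_measurable borel"
    by (intro borel_measurable_continuous_on_indicator uniformly_continuous_imp_continuous g) auto
  then have "(\<lambda>w. indicator (closure ?B) (b w) *\<^sub>R g (b w)) \<in> borel_measurable M"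
    by (rule measurable_compose [OF b])
  moreover have "indicator (closure ?B) (b w) *\<^sub>R g (b w) = x w" if "w \<in> space M" for w
  proof -
    have "b w \<in> ?B" using that by blast
    then have "b w \<in> closure ?B" by (rule subsetD [OF closure_subset])
    then show ?thesis using g(2) [OF \<open>b w \<in> ?B\<close>] p [OF that] by simp
  qed
  ultimately show ?thesis by (rule measurable_cong [THEN iffD1, rotated])
qed

text \<open>Smoothness from \<open>y\<close> to \<open>x\<close> is added to strong convexity from
  \<open>x\<close> to \<open>y\<close>. Mixing the two, instead of adding one of them to its own
  reversal, retains half of each gain at once.\<close>

lemma gradient_monotonicity:
  assumes "strongly_convex_wrt W m f G" and "smooth_wrt W Q f G"
  shows "m / 2 * wnorm2 W (x - y) + wnorm2 Q (G x - G y) / 2 \<le> wip W (G x - G y) (x - y)"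
proof -
  have "f x - f y - wip W (G y) (x - y) \<ge> 1 / 2 * wnorm2 Q (G x - G y)"
    using assms(2) by (simp add: smooth_wrt_def)
  moreover have "f y \<ge> f x + wip W (G x) (y - x) + m / 2 * wnorm2 W (y - x)"
    using assms(1) by (simp add: strongly_convex_wrt_def)
  moreover have "wnorm2 W (y - x) = wnorm2 W (x - y)" using wnorm2_minus [of W "x - y"] by simp
  ultimately show ?thesis by (simp add: wip_linear)
qed

text \<open>Adding the two smoothness inequalities bounds the \<open>Q\<close>-form of the gradient
  difference by an inner product, and Cauchy-Schwarz finishes. Lipschitz continuity provides
  measurability and square integrability of the gradients along the iterates.\<close>

lemma smooth_imp_lipschitz:
  fixes W Q :: "real^'n^'n"
  assumes sm: "smooth_wrt W Q f G" and Q: "pos_def Q"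
  obtains L where "0 \<le> L" "\<And>x y. norm (G x - G y) \<le> L * norm (x - y)"
proof
  let ?L = "onorm ((*v) W) / lambda_min Q"
  note lQ = lambda_min_pos_def [OF Q]
  show "0 \<le> ?L" using lQ by (simp add: onorm_pos_le matrix_vector_mul_bounded_linear)
  fix x y
  let ?d = "G x - G y"
  have "f x - f y - wip W (G y) (x - y) \<ge> 1 / 2 * wnorm2 Q ?d"
    and "f y - f x - wip W (G x) (y - x) \<ge> 1 / 2 * wnorm2 Q (G y - G x)"
    using sm by (simp_all add: smooth_wrt_def)
  moreover have "wnorm2 Q (G y - G x) = wnorm2 Q ?d" using wnorm2_minus [of Q ?d] by simp
  ultimately have "wnorm2 Q ?d \<le> wip W ?d (x - y)" by (simp add: wip_linear)
  also have "\<dots> \<le> norm ?d * norm (W *v (x - y))"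
    unfolding wip_def by (rule norm_cauchy_schwarz)
  also have "\<dots> \<le> norm ?d * (onorm ((*v) W) * norm (x - y))"
    by (intro mult_left_mono onorm) (auto simp: matrix_vector_mul_bounded_linear)
  finally have "lambda_min Q * (norm ?d)\<^sup>2 \<le> norm ?d * (onorm ((*v) W) * norm (x - y))"
    using lambda_min_le [OF pos_def_imp_symmetric [OF Q], of ?d] by linarith
  then have "norm ?d * (lambda_min Q * norm ?d) \<le> norm ?d * (onorm ((*v) W) * norm (x - y))"
    by (simp add: power2_eq_square mult_ac)
  moreover have "0 \<le> onorm ((*v) W) * norm (x - y)"
    by (simp add: onorm_pos_le matrix_vector_mul_bounded_linear)
  ultimately have "lambda_min Q * norm ?d \<le> onorm ((*v) W) * norm (x - y)"
    by (cases "?d = 0") auto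
  then show "norm ?d \<le> ?L * norm (x - y)" using lQ by (simp add: field_simps)
qed

section \<open>One step of the method\<close>

text \<open>A bound for a single outcome, shaped for averaging: on the right the sketch occurs only
  in \<open>K\<close>, \<open>t *\<^sub>R K\<close> and \<open>t\<^sup>2 *\<^sub>R K\<close>, and
  \<open>p\<close> only through \<open>C\<close>. Here \<open>y\<close> is the distance to
  \<open>xs\<close>, \<open>d\<close> the gradient difference and \<open>D\<close> the error of the
  gradient estimate.\<close>

lemma agent_step_pointwise:
  fixes W :: "real^'n^'n" and S :: "real^'p^'n"
  defines "K \<equiv> sketch_mat W S"
  assumes pd: "pos_def W" and "0 < al" and "0 < mu"
    and y': "wnorm2 W y' \<le> wnorm2 W (y - al *\<^sub>R (D + t *\<^sub>R (matrix_inv W *v (K *v (d - D)))) - al *\<^sub>R p)"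
    and p: "wnorm2 W p \<le> C"
  shows "wnorm2 W y' + c * al * wnorm2 W (D + matrix_inv W *v (K *v (d - D)))
    \<le> (1 + mu / 2 * al) * wnorm2 W y
      - 2 * al * (wip W y D + wip (t *\<^sub>R K) y d - wip (t *\<^sub>R K) y D)
      + 4 * al\<^sup>2 * (wip (t\<^sup>2 *\<^sub>R K) d d + wnorm2 W D - 2 * wip (t *\<^sub>R K) D D + wip (t\<^sup>2 *\<^sub>R K) D D)
      + c * al * (wnorm2 W D - wip K D D + wip K d d)
      + (2 * al / mu + 2 * al\<^sup>2) * C"
proof -
  note sym = pos_def_imp_symmetric [OF pd] and nonneg = pos_def_imp_wnorm2_nonneg [OF pd]
  define e where "e u = matrix_inv W *v (K *v u)" for u
  have e: "wip W v (e u) = wip K v u" "wip K (e v) u = wip K v u" "wnorm2 W (e u) = wip K u u" for u v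
    unfolding e_def K_def using sketch_direction [OF pd, where S = S]
    by (simp_all add: sketch_direction(1) [OF pd, symmetric]) (simp add: sketch_direction(3) [OF pd] wnorm2_def)
  have ed: "e (d - D) = e d - e D"
    by (simp add: e_def matrix_vector_mult_diff_distrib)
  have symK: "wip K d D = wip K D d"
    unfolding K_def by (rule wip_commute) (rule sketch_mat_props [OF pd])
  define g where "g = D + t *\<^sub>R e (d - D)"
  \<comment> \<open>\<open>D - e D\<close> and \<open>e d\<close> are orthogonal in the inner
    product of \<open>W\<close>, so this is Pythagoras without loss.\<close>
  have h: "wnorm2 W (D + e (d - D)) = wnorm2 W D - wip K D D + wip K d d"
    by (simp add: ed wnorm2_add wnorm2_diff sym wip_linear e symK)
  \<comment> \<open>Separating \<open>D\<close> from \<open>d\<close> costs a factor 2, separating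
    \<open>g\<close> from \<open>p\<close> another one; this gives the 4 in front of
    \<open>al\<^sup>2\<close>.\<close>
  have "g = (D - t *\<^sub>R e D) + t *\<^sub>R e d" by (simp add: g_def ed algebra_simps)
  then have "wnorm2 W g \<le> 2 * wnorm2 W (D - t *\<^sub>R e D) + 2 * wnorm2 W (t *\<^sub>R e d)"
    using wnorm2_add_le [OF sym nonneg] by simp
  also have "wnorm2 W (D - t *\<^sub>R e D) = wnorm2 W D - 2 * t * wip K D D + t\<^sup>2 * wip K D D"
    by (simp add: wnorm2_diff sym wnorm2_scaleR wip_linear e)
  finally have g: "wnorm2 W g \<le> 2 * (t\<^sup>2 * wip K d d + wnorm2 W D - 2 * (t * wip K D D) + t\<^sup>2 * wip K D D)"
    by (simp add: wnorm2_scaleR e algebra_simps)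
  have "wnorm2 W y' \<le> wnorm2 W (y - al *\<^sub>R (g + p))"
    using y' by (simp add: g_def e_def scaleR_add_right algebra_simps)
  also have "\<dots> = wnorm2 W y - al * (2 * wip W y (g + p)) + al\<^sup>2 * wnorm2 W (g + p)"
    unfolding wnorm2_diff [OF sym] wnorm2_scaleR wip_scaleR_right by simp
  also have "\<dots> = wnorm2 W y - al * (2 * wip W y g) + al * (2 * wip W y (- p)) + al\<^sup>2 * wnorm2 W (g + p)"
    by (simp add: wip_linear algebra_simps)
  finally have 1: "wnorm2 W y' \<le> \<dots>" .
  \<comment> \<open>The weight \<open>mu / 2\<close> spends half of the decrease that strong
    convexity will provide; its reciprocal produces \<open>2 * al / mu\<close>.\<close>
  have 2: "al * (2 * wip W y (- p)) \<le> al * (mu / 2 * wnorm2 W y + wnorm2 W p / (mu / 2))"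
    using wip_young [OF sym nonneg, of "mu / 2" y "- p"] \<open>0 < al\<close> \<open>0 < mu\<close> by simp
  have 3: "al\<^sup>2 * wnorm2 W (g + p) \<le> al\<^sup>2 * (2 * wnorm2 W g + 2 * wnorm2 W p)"
    by (intro mult_left_mono wnorm2_add_le sym nonneg) simp
  have 4: "al\<^sup>2 * wnorm2 W g \<le> al\<^sup>2 * (2 * (t\<^sup>2 * wip K d d + wnorm2 W D - 2 * (t * wip K D D) + t\<^sup>2 * wip K D D))"
    by (rule mult_left_mono [OF g]) simp
  have 5: "(2 * al / mu + 2 * al\<^sup>2) * wnorm2 W p \<le> (2 * al / mu + 2 * al\<^sup>2) * C"
    using p \<open>0 < al\<close> \<open>0 < mu\<close> by (intro mult_left_mono) auto
  have 6: "al * (wnorm2 W p / (mu / 2)) = (2 * al / mu) * wnorm2 W p" by simp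
  have 7: "wip W y g = wip W y D + t * wip K y d - t * wip K y D"
    by (simp add: g_def ed wip_linear e algebra_simps)
  show ?thesis
    using 1 2 3 4 5 6 unfolding e_def [symmetric] h 7 wip_matrix_scaleR
    by (simp only: distrib_left distrib_right) (simp add: algebra_simps)
qed

context prob_space
begin

text \<open>\<open>y\<close>, \<open>d\<close> and \<open>D\<close> are known before the sketch is
  drawn, whereas \<open>p\<close> enters only by a bound valid for every outcome and so may depend
  on the current sketch.\<close>

lemma agent_expected_step:
  fixes W :: "real^'n^'n" and S :: "'a \<Rightarrow> real^'p^'n" and y d D p y' D' :: "'a \<Rightarrow> real^'n"
  assumes pd: "pos_def W" and law: "sketch_law W L th" and pos: "0 < al" "0 < mu" "0 \<le> c"
    and ind: "indep_set (sets (vimage_algebra (space M) S borel)) (sets F)"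
    and F: "subalgebra M F"
    and S: "S \<in> borel_measurable M" "distr M borel S = L"
    and meas: "y \<in> borel_measurable F" "d \<in> borel_measurable F" "D \<in> borel_measurable F"
      "y' \<in> borel_measurable M" "D' \<in> borel_measurable M"
    and sq: "integrable M (\<lambda>w. (norm (y w))\<^sup>2)" "integrable M (\<lambda>w. (norm (d w))\<^sup>2)"
      "integrable M (\<lambda>w. (norm (D w))\<^sup>2)"
    and D': "\<And>w. w \<in> space M \<Longrightarrow> D' w = D w + matrix_inv W *v (sketch_mat W (S w) *v (d w - D w))"
    and y': "\<And>w. w \<in> space M \<Longrightarrow> wnorm2 W (y' w) \<le> wnorm2 W (y w
      - al *\<^sub>R (D w + th (S w) *\<^sub>R (matrix_inv W *v (sketch_mat W (S w) *v (d w - D w)))) - al *\<^sub>R p w)"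
    and p: "\<And>w. w \<in> space M \<Longrightarrow> wnorm2 W (p w) \<le> C"
    and mono: "\<And>w. mu / 2 * wnorm2 W (y w) + wnorm2 Q (d w) / 2 \<le> wip W (d w) (y w)"
    and condQ: "\<And>v. 4 * al * wnorm2 (sketch_second W L th) v \<le> wnorm2 Q v / 2 - c * wnorm2 (sketch_mean W L) v"
    and posQ: "\<And>v. 0 \<le> wnorm2 Q v"
    and condW: "\<And>v. mu / 2 * c * al * wnorm2 W v + 4 * al * (wnorm2 (sketch_second W L th) v - wnorm2 W v)
      \<le> c * wnorm2 (sketch_mean W L) v"
  shows "integrable M (\<lambda>w. wnorm2 W (y' w) + c * al * wnorm2 W (D' w))"
    and "(\<integral>w. wnorm2 W (y' w) + c * al * wnorm2 W (D' w) \<partial>M)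
      \<le> (1 - mu / 2 * al) * (\<integral>w. wnorm2 W (y w) + c * al * wnorm2 W (D w) \<partial>M)
        + (2 * al / mu + 2 * al\<^sup>2) * C"
proof -
  note sym = pos_def_imp_symmetric [OF pd]
  let ?K = "\<lambda>w. sketch_mat W (S w)" and ?t = "\<lambda>w. th (S w)"
  let ?M = "sketch_mean W L" and ?P = "sketch_second W L th"
  \<comment> \<open>Matrices are parameters of \<open>T\<close>, so the same expression can be
    evaluated at the random matrices and at their means; \<open>ET\<close> states that both have the
    same expectation.\<close>
  define T where "T K1 K2 K3 w = (1 + mu / 2 * al) * wnorm2 W (y w)
      - 2 * al * (wip W (y w) (D w) + wip K1 (y w) (d w) - wip K1 (y w) (D w))
      + 4 * al\<^sup>2 * (wip K2 (d w) (d w) + wnorm2 W (D w) - 2 * wip K1 (D w) (D w) + wip K2 (D w) (D w))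
      + c * al * (wnorm2 W (D w) - wip K3 (D w) (D w) + wip K3 (d w) (d w))
      + (2 * al / mu + 2 * al\<^sup>2) * C" for K1 K2 K3 w
  let ?T = "\<lambda>w. T (?t w *\<^sub>R ?K w) ((?t w)\<^sup>2 *\<^sub>R ?K w) (?K w) w"
  have int: "integrable L (\<lambda>s. th s *\<^sub>R sketch_mat W s)" "integrable L (\<lambda>s. (th s)\<^sup>2 *\<^sub>R sketch_mat W s)"
    "integrable L (sketch_mat W)" and mean: "(\<integral>s. th s *\<^sub>R sketch_mat W s \<partial>L) = W"
    using law by (simp_all add: sketch_law_def)
  note measM = meas(1-3) [THEN measurable_from_subalg [OF F]]
  have intW: "integrable M (\<lambda>w. wnorm2 W (y w))" "integrable M (\<lambda>w. wnorm2 W (D w))"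
    "integrable M (\<lambda>w. wip A (y w) (D w))" "integrable M (\<lambda>w. wip A (y w) (d w))"
    "integrable M (\<lambda>w. wip A (d w) (d w))" "integrable M (\<lambda>w. wip A (D w) (D w))" for A
    unfolding wnorm2_def by (intro integrable_wip measM sq)+
  note ex = expectation_wip_indep [OF ind F S]
  note ex1 = ex [OF int(1), unfolded mean] and ex2 = ex [OF int(2), folded sketch_second_def]
    and ex3 = ex [OF int(3), folded sketch_mean_def]
  note exs = ex1 [OF meas(1,2) sq(1,2)] ex1 [OF meas(1,3) sq(1,3)] ex1 [OF meas(3,3) sq(3,3)]
    ex2 [OF meas(2,2) sq(2,2)] ex2 [OF meas(3,3) sq(3,3)]
    ex3 [OF meas(2,2) sq(2,2)] ex3 [OF meas(3,3) sq(3,3)]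
  have intT: "integrable M ?T"
    unfolding T_def by (intro Bochner_Integration.integrable_add Bochner_Integration.integrable_diff
        integrable_mult_right exs intW) simp
  have intTb: "integrable M (T W ?P ?M)"
    unfolding T_def by (intro Bochner_Integration.integrable_add Bochner_Integration.integrable_diff
        integrable_mult_right exs intW) simp
  have ET: "(\<integral>w. ?T w \<partial>M) = (\<integral>w. T W ?P ?M w \<partial>M)"
    unfolding T_def by (simp add: exs intW)
  have le: "wnorm2 W (y' w) + c * al * wnorm2 W (D' w) \<le> ?T w" if "w \<in> space M" for w
    unfolding T_def D' [OF that] by (rule agent_step_pointwise [OF pd pos(1,2) y' [OF that] p [OF that]])
  have nonneg: "0 \<le> wnorm2 W (y' w) + c * al * wnorm2 W (D' w)" for w
    using pos by (intro add_nonneg_nonneg mult_nonneg_nonneg pos_def_imp_wnorm2_nonneg [OF pd]) auto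
  show int': "integrable M (\<lambda>w. wnorm2 W (y' w) + c * al * wnorm2 W (D' w))"
  proof (rule Bochner_Integration.integrable_bound [OF intT])
    show "(\<lambda>w. wnorm2 W (y' w) + c * al * wnorm2 W (D' w)) \<in> borel_measurable M"
      by (intro borel_measurable_add borel_measurable_times borel_measurable_wnorm2 meas borel_measurable_const)
    show "AE w in M. norm (wnorm2 W (y' w) + c * al * wnorm2 W (D' w)) \<le> norm (?T w)"
      using le nonneg by (intro AE_I2) (smt (verit) real_norm_def)
  qed
  have Tb: "T W ?P ?M w \<le> (1 - mu / 2 * al) * (wnorm2 W (y w) + c * al * wnorm2 W (D w))
      + (2 * al / mu + 2 * al\<^sup>2) * C" for w
  proof -
    define A B q Pd PD Md MD WD where "A = wnorm2 W (y w)" and "B = wip W (y w) (d w)"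
      and "q = wnorm2 Q (d w)" and "Pd = wnorm2 ?P (d w)" and "PD = wnorm2 ?P (D w)"
      and "Md = wnorm2 ?M (d w)" and "MD = wnorm2 ?M (D w)" and "WD = wnorm2 W (D w)"
    note defs = A_def B_def q_def Pd_def PD_def Md_def MD_def WD_def
    \<comment> \<open>These are the three conditions \<open>mono\<close>, \<open>condQ\<close> and
      \<open>condW\<close>, multiplied by \<open>al\<close>. \<open>X1\<close> enters twice because
      of the factor 2 of the cross term. Only half of the gained \<open>al * q\<close> is consumed
      by \<open>X2\<close>, and the other half is discarded.\<close>
    define X1 X2 X3 where "X1 = al * (mu / 2 * A + q / 2) - al * B"
      and "X2 = al * (4 * al * Pd) - al * (q / 2 - c * Md)"
      and "X3 = al * (mu / 2 * c * al * WD + 4 * al * (PD - WD)) - al * (c * MD)"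
    have "X1 \<le> 0" using mono [of w] pos by (simp add: X1_def defs wip_commute [OF sym])
    moreover have "X2 \<le> 0" using condQ [of "d w"] pos by (simp add: X2_def defs)
    moreover have "X3 \<le> 0" using condW [of "D w"] pos by (simp add: X3_def defs)
    moreover have "0 \<le> al * q" using posQ pos by (simp add: defs)
    moreover have "(1 + mu / 2 * al) * A - 2 * al * B + 4 * al\<^sup>2 * (Pd + WD - 2 * WD + PD)
        + c * al * (WD - MD + Md) = (1 - mu / 2 * al) * (A + c * al * WD) + 2 * X1 + X2 + X3 - al * q / 2"
      by (simp add: X1_def X2_def X3_def field_simps power2_eq_square)
    ultimately have "(1 + mu / 2 * al) * A - 2 * al * B + 4 * al\<^sup>2 * (Pd + WD - 2 * WD + PD)
        + c * al * (WD - MD + Md) \<le> (1 - mu / 2 * al) * (A + c * al * WD)"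
      by linarith
    then show ?thesis unfolding T_def wnorm2_def [symmetric] defs by (simp add: wnorm2_def)
  qed
  have intu: "integrable M (\<lambda>w. wnorm2 W (y w) + c * al * wnorm2 W (D w))" using intW by simp
  have "(\<integral>w. wnorm2 W (y' w) + c * al * wnorm2 W (D' w) \<partial>M) \<le> (\<integral>w. ?T w \<partial>M)"
    using int' intT le by (rule integral_mono)
  also have "\<dots> \<le> (\<integral>w. (1 - mu / 2 * al) * (wnorm2 W (y w) + c * al * wnorm2 W (D w))
      + (2 * al / mu + 2 * al\<^sup>2) * C \<partial>M)"
    unfolding ET using intu by (intro integral_mono intTb Tb) auto
  also have "\<dots> = (1 - mu / 2 * al) * (\<integral>w. wnorm2 W (y w) + c * al * wnorm2 W (D w) \<partial>M)
      + (2 * al / mu + 2 * al\<^sup>2) * C"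
    using intu by (simp add: prob_space)
  finally show "(\<integral>w. wnorm2 W (y' w) + c * al * wnorm2 W (D' w) \<partial>M)
      \<le> (1 - mu / 2 * al) * (\<integral>w. wnorm2 W (y w) + c * al * wnorm2 W (D w) \<partial>M)
        + (2 * al / mu + 2 * al\<^sup>2) * C" .
qed

end

lemma integrable_norm2_of_wnorm2:
  fixes u :: "'a \<Rightarrow> real^'n"
  assumes pd: "pos_def W" and "integrable M f" and u: "u \<in> borel_measurable M"
    and le: "\<And>w. w \<in> space M \<Longrightarrow> wnorm2 W (u w) \<le> f w"
  shows "integrable M (\<lambda>w. (norm (u w))\<^sup>2)"
proof (rule Bochner_Integration.integrable_bound)
  show "integrable M (\<lambda>w. f w / lambda_min W)" using assms(2) by simp
  show "(\<lambda>w. (norm (u w))\<^sup>2) \<in> borel_measurable M" using u by measurable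
  have "(norm (u w))\<^sup>2 \<le> f w / lambda_min W" if "w \<in> space M" for w
    using lambda_min_le [OF pos_def_imp_symmetric [OF pd], of "u w"] le [OF that] lambda_min_pos_def [OF pd]
    by (simp add: pos_le_divide_eq mult.commute)
  then show "AE w in M. norm ((norm (u w))\<^sup>2) \<le> norm (f w / lambda_min W)"
    by (intro AE_I2) (smt (verit) real_norm_def zero_le_power2)
qed

lemma borel_measurable_matrix_vector_mult:
  fixes A :: "'a \<Rightarrow> real^'n^'m"
  assumes "A \<in> borel_measurable M" and "v \<in> borel_measurable M"
  shows "(\<lambda>w. A w *v v w) \<in> borel_measurable M"
proof (rule borel_measurable_continuous_Pair [OF assms])
  show "continuous_on UNIV (\<lambda>x :: (real^'n^'m) \<times> (real^'n). fst x *v snd x)"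
    unfolding matrix_vector_mult_def
    by (intro continuous_on_vec_lambda continuous_intros)
qed

text \<open>The two upper bounds on \<open>al\<close> become matrix inequalities between forms of
  each agent: the first absorbs the terms in the error of the gradient estimate, the second those in
  the gradient difference. The signs of the denominators must be settled before clearing
  them.\<close>

lemma step_size_conditions:
  fixes W Q Ms Ps :: "'r::finite \<Rightarrow> real^'n^'n"
  assumes W: "\<And>i. pos_def (W i)" and symQ: "\<And>i. transpose (Q i) = Q i"
    and symM: "\<And>i. transpose (Ms i) = Ms i" and symP: "\<And>i. transpose (Ps i) = Ps i"
    and M0: "\<And>i v. 0 \<le> wnorm2 (Ms i) v" and P0: "\<And>i v. 0 \<le> wnorm2 (Ps i) v"
    and MW: "\<And>i v. wnorm2 (Ms i) v \<le> wnorm2 (W i) v"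
    and WP: "\<And>i v. wnorm2 (W i) v \<le> wnorm2 (Ps i) v"
    and "0 < c" and "0 < al"
    and al: "al \<le> min (c * lambda_min (block_diag Ms)
          / lambda_max ((gam * c) *\<^sub>R block_diag W + 4 *\<^sub>R (block_diag Ps - block_diag W)))
        (lambda_min ((1 / 2) *\<^sub>R block_diag Q - c *\<^sub>R block_diag Ms) / (4 * lambda_max (block_diag Ps)))"
  shows "4 * al * wnorm2 (Ps i) v \<le> wnorm2 (Q i) v / 2 - c * wnorm2 (Ms i) v"
    and "gam * c * al * wnorm2 (W i) v + 4 * al * (wnorm2 (Ps i) v - wnorm2 (W i) v) \<le> c * wnorm2 (Ms i) v"
    and "gam * al \<le> 1"
proof -
  define A where "A i = (gam * c) *\<^sub>R W i + 4 *\<^sub>R (Ps i - W i)" for i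
  define H where "H i = (1 / 2) *\<^sub>R Q i - c *\<^sub>R Ms i" for i
  have trans_scaleR: "transpose (t *\<^sub>R X) = t *\<^sub>R transpose X" for t and X :: "real^'n^'n"
    by (simp add: vec_eq_iff transpose_def)
  have symA: "transpose (A i) = A i" and symH: "transpose (H i) = H i" for i
    using pos_def_imp_symmetric [OF W, of i]
    by (simp_all add: A_def H_def transpose_add transpose_diff trans_scaleR symP symM symQ)
  have blk: "(gam * c) *\<^sub>R block_diag W + 4 *\<^sub>R (block_diag Ps - block_diag W) = block_diag A"
    "(1 / 2) *\<^sub>R block_diag Q - c *\<^sub>R block_diag Ms = block_diag H"
    by (simp_all add: block_diag_linear A_def [abs_def] H_def [abs_def])
  let ?a = "lambda_max (block_diag A)" and ?m = "lambda_min (block_diag Ms)"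
  let ?h = "lambda_min (block_diag H)" and ?p = "lambda_max (block_diag Ps)"
  have al1: "al \<le> c * ?m / ?a" and al2: "al \<le> ?h / (4 * ?p)" using al by (simp_all add: blk)
  have "0 \<le> ?m" and "0 \<le> ?p" using lambda_block_diag_nonneg symM symP M0 P0 by blast+
  \<comment> \<open>A nonpositive denominator would make the quotient at most 0, also when it is 0
    since division by zero yields 0, against \<open>0 < al\<close>.\<close>
  have "0 < ?a"
  proof (rule ccontr)
    assume "\<not> 0 < ?a"
    then have "c * ?m / ?a \<le> 0" using \<open>0 < c\<close> \<open>0 \<le> ?m\<close> by (intro divide_nonneg_nonpos) auto
    with al1 \<open>0 < al\<close> show False by linarith
  qed
  then have ca: "al * ?a \<le> c * ?m" using al1 by (simp add: pos_le_divide_eq)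
  have "?p \<noteq> 0" using al2 \<open>0 < al\<close> by auto
  then have cp: "al * (4 * ?p) \<le> ?h" using al2 \<open>0 \<le> ?p\<close> by (simp add: pos_le_divide_eq)
  show "4 * al * wnorm2 (Ps i) v \<le> wnorm2 (Q i) v / 2 - c * wnorm2 (Ms i) v" for i v
  proof -
    have "4 * al * wnorm2 (Ps i) v \<le> 4 * al * (?p * (norm v)\<^sup>2)"
      using lambda_block_diag(2) [OF symP] \<open>0 < al\<close> by (intro mult_left_mono) auto
    also have "\<dots> = al * (4 * ?p) * (norm v)\<^sup>2" by simp
    also have "\<dots> \<le> ?h * (norm v)\<^sup>2" using cp by (rule mult_right_mono) simp
    also have "\<dots> \<le> wnorm2 (H i) v" by (rule lambda_block_diag(1) [OF symH])
    also have "\<dots> = wnorm2 (Q i) v / 2 - c * wnorm2 (Ms i) v"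
      by (simp add: H_def wnorm2_def wip_matrix_linear)
    finally show ?thesis .
  qed
  show cond: "gam * c * al * wnorm2 (W i) v + 4 * al * (wnorm2 (Ps i) v - wnorm2 (W i) v) \<le> c * wnorm2 (Ms i) v"
    for i v
  proof -
    have "gam * c * al * wnorm2 (W i) v + 4 * al * (wnorm2 (Ps i) v - wnorm2 (W i) v) = al * wnorm2 (A i) v"
      by (simp add: A_def wnorm2_def wip_matrix_linear algebra_simps)
    also have "\<dots> \<le> al * (?a * (norm v)\<^sup>2)"
      using lambda_block_diag(2) [OF symA] \<open>0 < al\<close> by (intro mult_left_mono) auto
    also have "\<dots> = al * ?a * (norm v)\<^sup>2" by simp
    also have "\<dots> \<le> c * ?m * (norm v)\<^sup>2" using ca by (rule mult_right_mono) simp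
    also have "\<dots> = c * (?m * (norm v)\<^sup>2)" by simp
    also have "\<dots> \<le> c * wnorm2 (Ms i) v"
      using lambda_block_diag(1) [OF symM] \<open>0 < c\<close> by (intro mult_left_mono) auto
    finally show ?thesis .
  qed
  \<comment> \<open>On any nonzero vector, dropping the nonnegative Phi - W and bounding M by W
    leaves \<open>gam * al\<close> times a positive number below that same number.\<close>
  obtain v :: "real^'n" where "v \<noteq> 0" using nonzero_Basis SOME_Basis by blast
  then have Wv: "0 < c * wnorm2 (W i) v" for i using W \<open>0 < c\<close> by (simp add: pos_def_def)
  fix i
  have "0 \<le> 4 * al * (wnorm2 (Ps i) v - wnorm2 (W i) v)" using WP \<open>0 < al\<close> by simp
  moreover have "c * wnorm2 (Ms i) v \<le> c * wnorm2 (W i) v" using MW \<open>0 < c\<close> by simp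
  ultimately have "gam * al * (c * wnorm2 (W i) v) \<le> 1 * (c * wnorm2 (W i) v)"
    using cond [of i v] by (simp add: mult_ac)
  then show "gam * al \<le> 1" using Wv by (rule mult_right_le_imp_le)
qed

lemma sketch_sampling_indep:
  assumes "sketch_sampling P F D S"
  shows "prob_space.indep_set P (sets (vimage_algebra (space P) (S i k) borel)) (sets (F k))"
proof -
  interpret prob_space P using assms by (simp add: sketch_sampling_def)
  let ?V = "vimage_algebra (space P) (\<lambda>w i. S i k w) (Pi\<^sub>M UNIV (\<lambda>_. borel))"
  have "(\<lambda>w i. S i k w) \<in> measurable ?V (Pi\<^sub>M UNIV (\<lambda>_. borel))"
    by (rule measurable_vimage_algebra1) (simp add: space_PiM)
  then have "(\<lambda>w. (\<lambda>i. S i k w) i) \<in> borel_measurable ?V"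
    by (rule measurable_compose [OF _ measurable_component_singleton]) simp
  then have "sets (vimage_algebra (space P) (S i k) borel) \<subseteq> sets ?V"
    by (intro sets_image_in_sets) auto
  moreover have "indep_set (sets ?V) (sets (F k))"
    using assms by (simp add: sketch_sampling_def)
  ultimately show ?thesis unfolding indep_sets2_eq by blast
qed

lemma red_sega_step:
  assumes "red_sega W G r th a ph al E P F S z sg x0 h0 x h" and "w \<in> space P"
  shows "x i 0 w = x0 i" and "h i 0 w = h0 i"
    and "j \<in> neighbours (E k) i \<Longrightarrow> \<exists>v. sg i j k w \<in> subdiff (mat 1) (\<lambda>v. ereal (lp_norm a v)) v"
    and "h i (Suc k) w = h i k w
      + matrix_inv (W i) *v (sketch_mat (W i) (S i k w) *v (G i (x i k w) - h i k w))"
    and "is_arg_min (\<lambda>y. r i y + ereal (1 / (2 * al k) * wnorm2 (W i) (y - (x i k w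
        - al k *\<^sub>R (h i k w + th i (S i k w) *\<^sub>R
            (matrix_inv (W i) *v (sketch_mat (W i) (S i k w) *v (G i (x i k w) - h i k w))))
        - (al k * ph) *\<^sub>R (\<Sum>j\<in>neighbours (E k) i. sg i j k w))))) (\<lambda>_. True) (x i (Suc k) w)"
  using assms unfolding red_sega_def Let_def by blast+

lemma lyapunov_eq_sum:
  "lyapunov W G c al xs X H
    = (\<Sum>i\<in>UNIV. wnorm2 (W i) (X i - xs) + c * al * wnorm2 (W i) (H i - G i xs))"
  "sq_error W xs X = (\<Sum>i\<in>UNIV. wnorm2 (W i) (X i - xs))"
  by (simp_all add: lyapunov_def sq_error_def col_diff wnorm2_block_diag sum.distrib sum_distrib_left)

theorem theorem2:
  fixes B :: "'b set"
    and f :: "'r::{finite,linorder} \<Rightarrow> real^'n \<Rightarrow> real"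
    and G :: "'r \<Rightarrow> real^'n \<Rightarrow> real^'n"
    and r :: "'r \<Rightarrow> real^'n \<Rightarrow> ereal"
    and W Q :: "'r \<Rightarrow> real^'n^'n"
    and mui :: "'r \<Rightarrow> real"
    and a ph c al mu gam Gam1 Gam2 :: real
    and N :: "'u measure" and Net :: "nat \<Rightarrow> 'u \<Rightarrow> ('r + 'b) set set" and u :: 'u
    and E :: "nat \<Rightarrow> ('r + 'b) set set"
    and P :: "'w measure" and F :: "nat \<Rightarrow> 'w measure"
    and D :: "'r \<Rightarrow> (real^'p^'n) measure"
    and S :: "'r \<Rightarrow> nat \<Rightarrow> 'w \<Rightarrow> real^'p^'n"
    and th :: "'r \<Rightarrow> real^'p^'n \<Rightarrow> real"
    and z :: "'r \<Rightarrow> 'b \<Rightarrow> nat \<Rightarrow> 'w \<Rightarrow> real^'n"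
    and sg :: "'r \<Rightarrow> 'r + 'b \<Rightarrow> nat \<Rightarrow> 'w \<Rightarrow> real^'n"
    and x0 h0 :: "'r \<Rightarrow> real^'n"
    and x h :: "'r \<Rightarrow> nat \<Rightarrow> 'w \<Rightarrow> real^'n"
    and xs :: "real^'n" and rs :: "'r \<Rightarrow> real^'n"
    and WW QQ MM PP :: "real^('r \<times> 'n)^('r \<times> 'n)"
  assumes "finite B" and "1 \<le> a"
    and "\<And>i. pos_def (W i)"
    and "\<And>i. is_W_gradient (W i) (f i) (G i)"
    and "\<And>i. closed_proper_convex (r i)"
    and "\<And>i. 0 < mui i \<and> strongly_convex_wrt (W i) (mui i) (f i) (G i)"
    and mu: "mu = Min (range mui)"
    and "\<And>i. pos_def (Q i) \<and> smooth_wrt (W i) (Q i) (f i) (G i)"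
    \<comment> \<open>\<open>E\<close> is the realization of the random network at the outcome \<open>u\<close>\<close>
    and "random_network N B Net" and "u \<in> space N" and "E = (\<lambda>k. Net k u)"
    and "sufficient_connectivity E"
    and "\<And>i. sketch_law (W i) (D i) (th i)"
    and "sketch_sampling P F D S"
    and "is_arg_min (\<lambda>y. \<Sum>i\<in>UNIV. ereal (f i y) + r i y) (\<lambda>_. True) xs"
    and "\<And>i. rs i \<in> subdiff (W i) (r i) xs"
    and "ph \<ge> real CARD('r) powr (3 / 2) * sqrt (real (card (avg_edges E)))
           / min_nonzero_singular_value (incidence E)
           * Max (range (\<lambda>i. infnorm (G i xs + rs i)))"
    and WW: "WW = block_diag W" and QQ: "QQ = block_diag Q"
    and MM: "MM = block_diag (\<lambda>i. sketch_mean (W i) (D i))"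
    and PP: "PP = block_diag (\<lambda>i. sketch_second (W i) (D i) (th i))"
    and gam: "gam = mu / 2"
    and Gam1: "Gam1 = 4 * real CARD('n) * ph\<^sup>2 * neighbour_weight W E"
    and Gam2: "Gam2 = 16 * real CARD('n) * ph\<^sup>2 / mu * neighbour_weight W E"
    and "0 < c" and "c < lambda_min QQ / (2 * lambda_max MM)"
    and "0 < al"
    and "al \<le> min (c * lambda_min MM / lambda_max ((gam * c) *\<^sub>R WW + 4 *\<^sub>R (PP - WW)))
                  (lambda_min ((1 / 2) *\<^sub>R QQ - c *\<^sub>R MM) / (4 * lambda_max PP))"
    and "red_sega W G r th a ph (\<lambda>_. al) E P F S z sg x0 h0 x h"
  shows "(\<forall>k. integrable P (\<lambda>w. lyapunov W G c al xs (\<lambda>i. x i k w) (\<lambda>i. h i k w)) \<and>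
             (\<integral>w. lyapunov W G c al xs (\<lambda>i. x i k w) (\<lambda>i. h i k w) \<partial>P)
               \<le> (1 - gam * al) ^ k * lyapunov W G c al xs x0 h0
                 + (Gam1 * al + Gam2) / gam * (1 - (1 - gam * al) ^ k)) \<and>
         (\<forall>k. integrable P (\<lambda>w. sq_error W xs (\<lambda>i. x i k w))) \<and>
         limsup (\<lambda>k. ereal (\<integral>w. sq_error W xs (\<lambda>i. x i k w) \<partial>P)) \<le> ereal ((Gam1 * al + Gam2) / gam)"
proof -
  note W = assms(3) and cpc = assms(5) and law = assms(13) and red = assms(29) and sampling = assms(14)
  have Q: "pos_def (Q i)" and sm: "smooth_wrt (W i) (Q i) (f i) (G i)" for i using assms(8) by auto
  interpret prob_space P using sampling by (simp add: sketch_sampling_def)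
  have F: "subalgebra P (F k)" and S: "S i k \<in> borel_measurable (F (Suc k))"
    and SD: "distr P borel (S i k) = D i" and filt: "filtration (space P) F" for i k
    using sampling by (simp_all add: sketch_sampling_def)
  have spF: "space (F k) = space P" for k using F by (simp add: subalgebra_def)
  have Fmono: "v \<in> borel_measurable (F (Suc k))" if "v \<in> borel_measurable (F k)"
    for v :: "'w \<Rightarrow> real^'n" and k
  proof (rule measurable_from_subalg [OF _ that])
    show "subalgebra (F (Suc k)) (F k)"
      using filtration.sets_F_mono [OF filt, of k "Suc k"] by (simp add: subalgebra_def spF)
  qed
  note SP = measurable_from_subalg [OF F S]

  have "mu \<in> range mui" unfolding mu by (rule Min_in) auto
  then have mu0: "0 < mu" using assms(6) by auto
  have mu_le: "mu \<le> mui i" for i unfolding mu by simp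
  have gam0: "0 < gam" using mu0 gam by simp
  have al0: "0 < al" and c0: "0 < c" using assms(25,27) by simp_all
  note means = sketch_means [OF law W]
  note conds = step_size_conditions [where Ms = "\<lambda>i. sketch_mean (W i) (D i)"
      and Ps = "\<lambda>i. sketch_second (W i) (D i) (th i)",
      OF W pos_def_imp_symmetric [OF Q] means c0 al0 assms(28) [unfolded WW QQ MM PP]]

  have EB: "E k \<subseteq> agent_pairs B" for k
    using assms(9-11) by (auto simp: random_network_def)
  note nb = neighbours_bound [where E = E, OF assms(1) EB]
  note ref = reference_subgradient [OF assms(12) assms(4) cpc assms(15) assms(16) assms(17)]
  have ph0: "0 \<le> ph" by (rule ref(1))
  \<comment> \<open>\<open>rr\<close> may differ from the given \<open>rs\<close>: with a single
    reliable agent, the negative gradient at \<open>xs\<close> is the suitable subgradient.\<close>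
  obtain rr where rr: "\<And>i. rr i \<in> subdiff (W i) (r i) xs"
    "\<And>i. norm (G i xs + rr i) \<le> ph * sqrt (real CARD('n)) * real (card (all_reliable_neighbours E i))"
    using ref(2) by metis

  define C where "C i = 2 * real CARD('n) * ph\<^sup>2 * ((4 * (real (card (all_reliable_neighbours E i)))\<^sup>2
    + (real (card (all_byzantine_neighbours E i)))\<^sup>2) * lambda_max (W i))" for i
  \<comment> \<open>\<open>xs\<close> is compared as the proximal point of
    \<open>xs + al *\<^sub>R rr i\<close>. Replacing \<open>h i\<close> by its error relative to
    \<open>G i xs\<close> then leaves \<open>G i xs + rr i\<close>, which joins the penalty
    subgradients as perturbation.\<close>
  define p where "p i k w = ph *\<^sub>R (\<Sum>j\<in>neighbours (E k) i. sg i j k w) + (G i xs + rr i)" for i k w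
  have lmax0: "0 \<le> lambda_max (W i)" for i
    using eigenvalue_nonneg lambda_max_in_eigenvalues pos_def_imp_symmetric [OF W]
      pos_def_imp_wnorm2_nonneg [OF W] by blast
  have noise: "wnorm2 (W i) (p i k w) \<le> C i" if "w \<in> space P" for i k w
    unfolding p_def C_def
  proof (rule penalty_noise_bound [OF pos_def_imp_symmetric [OF W] lmax0 ph0 _ rr(2)])
    show "norm (sg i j k w) \<le> sqrt (real CARD('n))" if "j \<in> neighbours (E k) i" for j
      using red_sega_step(3) [OF red \<open>w \<in> space P\<close> that] lp_norm_subgradient_bound [of a] assms(2) by fastforce
    show "real (card (neighbours (E k) i))
        \<le> real (card (all_reliable_neighbours E i)) + real (card (all_byzantine_neighbours E i))"
      using nb(2) [where k = k and i = i] by linarith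
  qed

  \<comment> \<open>From here on \<open>u\<close> is the share of one agent in the Lyapunov
    function, no longer the outcome of the random network.\<close>
  define u where "u i k w = wnorm2 (W i) (x i k w - xs) + c * al * wnorm2 (W i) (h i k w - G i xs)" for i k w
  define u0 where "u0 i = wnorm2 (W i) (x0 i - xs) + c * al * wnorm2 (W i) (h0 i - G i xs)" for i
  define K where "K i = (2 * al / mu + 2 * al\<^sup>2) * C i" for i
  define rho where "rho = 1 - gam * al"
  have rho: "0 \<le> rho" "rho < 1" using conds(3) gam0 al0 by (simp_all add: rho_def)

  \<comment> \<open>\<open>K i / (gam * al)\<close> is the fixed point of the map sending q to
    \<open>rho * q + K i\<close>, which makes the one-step bound telescope.\<close>
  have main: "x i k \<in> borel_measurable (F k) \<and> h i k \<in> borel_measurable (F k) \<and>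
      integrable P (\<lambda>w. (norm (x i k w - xs))\<^sup>2) \<and> integrable P (\<lambda>w. (norm (h i k w - G i xs))\<^sup>2) \<and>
      integrable P (u i k) \<and> (\<integral>w. u i k w \<partial>P) \<le> rho ^ k * u0 i + K i / (gam * al) * (1 - rho ^ k)" for i k
  proof (induction k)
    case 0
    note init = red_sega_step(1,2) [OF red]
    have "x i 0 \<in> borel_measurable (F 0)" "h i 0 \<in> borel_measurable (F 0)"
      by (subst measurable_cong [where g = "\<lambda>_. x0 i"] measurable_cong [where g = "\<lambda>_. h0 i"];
          simp add: spF init)+
    moreover have "integrable P (\<lambda>w. (norm (x i 0 w - xs))\<^sup>2)"
      by (subst Bochner_Integration.integrable_cong [OF refl, where g = "\<lambda>_. (norm (x0 i - xs))\<^sup>2"])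
        (simp_all add: init)
    moreover have "integrable P (\<lambda>w. (norm (h i 0 w - G i xs))\<^sup>2)"
      by (subst Bochner_Integration.integrable_cong [OF refl, where g = "\<lambda>_. (norm (h0 i - G i xs))\<^sup>2"])
        (simp_all add: init)
    moreover have "u i 0 w = u0 i" if "w \<in> space P" for w
      using that by (simp add: u_def u0_def init)
    then have "integrable P (u i 0)" "(\<integral>w. u i 0 w \<partial>P) = u0 i"
      using Bochner_Integration.integrable_cong [of P P "u i 0" "\<lambda>_. u0 i"]
        Bochner_Integration.integral_cong [of P P "u i 0" "\<lambda>_. u0 i"] by (simp_all add: prob_space)
    ultimately show ?case by simp
  next
    case (Suc k)
    then have mx: "x i k \<in> borel_measurable (F k)" and mh: "h i k \<in> borel_measurable (F k)"
      and sq: "integrable P (\<lambda>w. (norm (x i k w - xs))\<^sup>2)" "integrable P (\<lambda>w. (norm (h i k w - G i xs))\<^sup>2)"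
      and IH: "(\<integral>w. u i k w \<partial>P) \<le> rho ^ k * u0 i + K i / (gam * al) * (1 - rho ^ k)"
      by blast+
    \<comment> \<open>The constant is needed twice: for continuity of the gradient and to dominate
      the square of \<open>d\<close> by that of \<open>y\<close>.\<close>
    obtain L where L: "0 \<le> L" "\<And>y y'. norm (G i y - G i y') \<le> L * norm (y - y')"
      using smooth_imp_lipschitz [OF sm Q] by blast
    have "L-lipschitz_on UNIV (G i)" using L by (intro lipschitz_onI) (auto simp: dist_norm)
    then have contG: "continuous_on UNIV (G i)" by (rule lipschitz_on_continuous_on)
    then have mG: "(\<lambda>w. G i (x i k w)) \<in> borel_measurable (F k)"
      using mx by (rule borel_measurable_continuous_on)
    define dir where "dir w = matrix_inv (W i) *v (sketch_mat (W i) (S i k w) *v (G i (x i k w) - h i k w))" for w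
    define xb where "xb w = x i k w - al *\<^sub>R (h i k w + th i (S i k w) *\<^sub>R dir w)
      - (al * ph) *\<^sub>R (\<Sum>j\<in>neighbours (E k) i. sg i j k w)" for w
    have hS: "h i (Suc k) w = h i k w + dir w" if "w \<in> space P" for w
      unfolding dir_def by (rule red_sega_step(4) [OF red that])
    have xS: "is_arg_min (\<lambda>y. r i y + ereal (1 / (2 * al) * wnorm2 (W i) (y - xb w))) (\<lambda>_. True) (x i (Suc k) w)"
      if "w \<in> space P" for w
      using red_sega_step(5) [OF red that, where i = i and k = k] unfolding xb_def dir_def .
    have mdir: "dir \<in> borel_measurable (F (Suc k))" "(\<lambda>w. th i (S i k w) *\<^sub>R dir w) \<in> borel_measurable (F (Suc k))"
    proof -
      have "sketch_mat (W i) \<in> borel_measurable (D i)" "(\<lambda>s. th i s *\<^sub>R sketch_mat (W i) s) \<in> borel_measurable (D i)"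
        and sD: "sets (D i) = sets borel"
        using law [of i] by (auto simp: sketch_law_def)
      then have mK: "(sketch_mat (W i) :: real^'p^'n \<Rightarrow> _) \<in> borel_measurable borel"
        "(\<lambda>s. th i s *\<^sub>R sketch_mat (W i) s) \<in> borel_measurable borel"
        by (simp_all only: measurable_cong_sets [OF sD refl])
      have md: "(\<lambda>w. G i (x i k w) - h i k w) \<in> borel_measurable (F (Suc k))"
        using Fmono [OF mG] Fmono [OF mh] by (rule borel_measurable_diff)
      show "dir \<in> borel_measurable (F (Suc k))"
        unfolding dir_def
        by (intro borel_measurable_matrix_vector_mult borel_measurable_const md measurable_compose [OF S mK(1)])
      \<comment> \<open>Measurability is known for the product of \<open>th i\<close> with the
        sketched matrix, so the scalar is first moved onto the matrix.\<close>
      have "th i (S i k w) *\<^sub>R dir w = matrix_inv (W i) *v ((th i (S i k w) *\<^sub>R sketch_mat (W i) (S i k w))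
          *v (G i (x i k w) - h i k w))" for w
        by (simp add: dir_def scaleR_matrix_vector_assoc [symmetric] matrix_vector_mult_scaleR)
      then show "(\<lambda>w. th i (S i k w) *\<^sub>R dir w) \<in> borel_measurable (F (Suc k))"
        by (simp only:) (intro borel_measurable_matrix_vector_mult borel_measurable_const md
            measurable_compose [OF S mK(2)])
    qed
    have msg: "sg i j k \<in> borel_measurable (F (Suc k))" for j
      using red by (simp add: red_sega_def)
    have mhS: "h i (Suc k) \<in> borel_measurable (F (Suc k))"
    proof (subst measurable_cong)
      show "h i (Suc k) w = h i k w + dir w" if "w \<in> space (F (Suc k))" for w using that hS by (simp add: spF)
      show "(\<lambda>w. h i k w + dir w) \<in> borel_measurable (F (Suc k))"
        using Fmono [OF mh] mdir(1) by (rule borel_measurable_add)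
    qed
    have "xb \<in> borel_measurable (F (Suc k))"
      unfolding xb_def
      by (intro borel_measurable_diff borel_measurable_add borel_measurable_scaleR borel_measurable_const
          borel_measurable_sum Fmono [OF mx] Fmono [OF mh] mdir msg)
    then have mxS: "x i (Suc k) \<in> borel_measurable (F (Suc k))"
      by (rule prox_measurable [OF W al0 cpc]) (use xS in \<open>simp only: spF\<close>)

    define y where "y w = x i k w - xs" for w
    define d where "d w = G i (x i k w) - G i xs" for w
    define De where "De w = h i k w - G i xs" for w
    have meas: "y \<in> borel_measurable (F k)" "d \<in> borel_measurable (F k)" "De \<in> borel_measurable (F k)"
      unfolding y_def d_def De_def using mx mG mh by measurable
    have meas': "(\<lambda>w. x i (Suc k) w - xs) \<in> borel_measurable P" "(\<lambda>w. h i (Suc k) w - G i xs) \<in> borel_measurable P"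
      using measurable_from_subalg [OF F mxS] measurable_from_subalg [OF F mhS] by measurable
    have sqd: "integrable P (\<lambda>w. (norm (d w))\<^sup>2)"
    proof (rule Bochner_Integration.integrable_bound)
      show "integrable P (\<lambda>w. L\<^sup>2 * (norm (y w))\<^sup>2)" unfolding y_def using sq(1) by simp
      show "(\<lambda>w. (norm (d w))\<^sup>2) \<in> borel_measurable P"
        using measurable_from_subalg [OF F meas(2)] by measurable
      have "(norm (d w))\<^sup>2 \<le> (L * norm (y w))\<^sup>2" for w
        unfolding d_def y_def by (intro power_mono L) simp
      then show "AE w in P. norm ((norm (d w))\<^sup>2) \<le> norm (L\<^sup>2 * (norm (y w))\<^sup>2)"
        by (simp add: power_mult_distrib)
    qed
    have dir: "dir w = matrix_inv (W i) *v (sketch_mat (W i) (S i k w) *v (d w - De w))" for w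
      by (simp add: dir_def d_def De_def)
    have step: "integrable P (u i (Suc k)) \<and> (\<integral>w. u i (Suc k) w \<partial>P) \<le> rho * (\<integral>w. u i k w \<partial>P) + K i"
    proof -
      have 1: "h i (Suc k) w - G i xs
          = De w + matrix_inv (W i) *v (sketch_mat (W i) (S i k w) *v (d w - De w))" if "w \<in> space P" for w
        unfolding dir [symmetric] using hS [OF that] by (simp add: De_def)
      have 2: "wnorm2 (W i) (x i (Suc k) w - xs) \<le> wnorm2 (W i) (y w - al *\<^sub>R (De w + th i (S i k w) *\<^sub>R
          (matrix_inv (W i) *v (sketch_mat (W i) (S i k w) *v (d w - De w)))) - al *\<^sub>R p i k w)"
        if "w \<in> space P" for w
      proof -
        have "xb w - (xs + al *\<^sub>R rr i) = y w - al *\<^sub>R (De w + th i (S i k w) *\<^sub>R dir w) - al *\<^sub>R p i k w"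
          by (simp add: xb_def y_def De_def p_def algebra_simps)
        then show ?thesis
          using prox_nonexpansive [OF W al0 cpc xS [OF that] rr(1)] unfolding dir [symmetric] by simp
      qed
      have 3: "mu / 2 * wnorm2 (W i) (y w) + wnorm2 (Q i) (d w) / 2 \<le> wip (W i) (d w) (y w)" for w
      proof -
        have "mu * wnorm2 (W i) (y w) \<le> mui i * wnorm2 (W i) (y w)"
          by (rule mult_right_mono [OF mu_le pos_def_imp_wnorm2_nonneg [OF W]])
        moreover have "mui i / 2 * wnorm2 (W i) (y w) + wnorm2 (Q i) (d w) / 2 \<le> wip (W i) (d w) (y w)"
          unfolding y_def d_def using assms(6) sm by (intro gradient_monotonicity) blast+
        ultimately show ?thesis by simp
      qed
      note ag = agent_expected_step [OF W law al0 mu0 less_imp_le [OF c0] sketch_sampling_indep [OF sampling] F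
          SP SD meas meas' sq(1) [folded y_def] sqd sq(2) [folded De_def] 1 2 noise 3 conds(1)
          pos_def_imp_wnorm2_nonneg [OF Q] conds(2) [unfolded gam]]
      show ?thesis
        using ag unfolding u_def [abs_def] K_def rho_def gam y_def De_def by simp
    qed
    then have int: "integrable P (u i (Suc k))" by blast
    have "integrable P (\<lambda>w. (norm (x i (Suc k) w - xs))\<^sup>2)"
    proof (rule integrable_norm2_of_wnorm2 [OF W int meas'(1)])
      show "wnorm2 (W i) (x i (Suc k) w - xs) \<le> u i (Suc k) w" for w
        using c0 al0 pos_def_imp_wnorm2_nonneg [OF W] by (simp add: u_def)
    qed
    moreover have "integrable P (\<lambda>w. (norm (h i (Suc k) w - G i xs))\<^sup>2)"
    proof (rule integrable_norm2_of_wnorm2 [OF W _ meas'(2)])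
      show "integrable P (\<lambda>w. u i (Suc k) w / (c * al))" using int by simp
      show "wnorm2 (W i) (h i (Suc k) w - G i xs) \<le> u i (Suc k) w / (c * al)" for w
        using c0 al0 pos_def_imp_wnorm2_nonneg [OF W, of i "x i (Suc k) w - xs"]
        by (simp add: u_def pos_le_divide_eq mult.commute)
    qed
    moreover have "(\<integral>w. u i (Suc k) w \<partial>P) \<le> rho ^ Suc k * u0 i + K i / (gam * al) * (1 - rho ^ Suc k)"
    proof -
      have telescope: "rho * (rho ^ k * u0 i + q * (1 - rho ^ k)) + q * (1 - rho)
          = rho ^ Suc k * u0 i + q * (1 - rho ^ Suc k)" for q
        by (simp add: algebra_simps)
      have "(\<integral>w. u i (Suc k) w \<partial>P) \<le> rho * (rho ^ k * u0 i + K i / (gam * al) * (1 - rho ^ k)) + K i"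
        using step mult_left_mono [OF IH rho(1)] by linarith
      moreover have "K i / (gam * al) * (1 - rho) = K i" using gam0 al0 by (simp add: rho_def)
      ultimately show ?thesis using telescope [of "K i / (gam * al)"] by linarith
    qed
    ultimately show ?case using mxS mhS int by blast
  qed

  have sumC: "sum C UNIV = 2 * real CARD('n) * ph\<^sup>2 * neighbour_weight W E"
    by (simp add: C_def neighbour_weight_def sum_distrib_left)
  have nw0: "0 \<le> neighbour_weight W E"
    unfolding neighbour_weight_def by (intro sum_nonneg mult_nonneg_nonneg lmax0) simp
  let ?Gam = "(Gam1 * al + Gam2) / gam"
  have sumK: "(\<Sum>i\<in>UNIV. K i / (gam * al)) \<le> ?Gam"
  proof -
    let ?c = "real CARD('n) * ph\<^sup>2 * neighbour_weight W E"
    have "(\<Sum>i\<in>UNIV. K i / (gam * al)) = (2 * al / mu + 2 * al\<^sup>2) * (2 * ?c) / (gam * al)"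
      unfolding sum_divide_distrib [symmetric] K_def sum_distrib_left [symmetric] sumC by simp
    also have "\<dots> = (4 * ?c * al + 4 * ?c / mu) / gam"
      using al0 gam0 mu0 by (simp add: field_simps power2_eq_square)
    \<comment> \<open>The first summand matches \<open>Gam1\<close> exactly, the second is a quarter
      of \<open>Gam2\<close>.\<close>
    also have "\<dots> \<le> ?Gam"
      using gam0 mu0 nw0 unfolding Gam1 Gam2 by (intro divide_right_mono add_mono) (auto intro!: divide_right_mono)
    finally show ?thesis .
  qed
  have lyap: "lyapunov W G c al xs (\<lambda>i. x i k w) (\<lambda>i. h i k w) = (\<Sum>i\<in>UNIV. u i k w)" for k w
    by (simp add: lyapunov_eq_sum u_def)
  have intL: "integrable P (\<lambda>w. lyapunov W G c al xs (\<lambda>i. x i k w) (\<lambda>i. h i k w))" for k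
    unfolding lyap using main by (intro Bochner_Integration.integrable_sum) blast
  have bound: "(\<integral>w. lyapunov W G c al xs (\<lambda>i. x i k w) (\<lambda>i. h i k w) \<partial>P)
      \<le> rho ^ k * lyapunov W G c al xs x0 h0 + ?Gam * (1 - rho ^ k)" for k
  proof -
    have "(\<integral>w. lyapunov W G c al xs (\<lambda>i. x i k w) (\<lambda>i. h i k w) \<partial>P) = (\<Sum>i\<in>UNIV. \<integral>w. u i k w \<partial>P)"
      unfolding lyap using main by (intro Bochner_Integration.integral_sum) blast
    also have "\<dots> \<le> (\<Sum>i\<in>UNIV. rho ^ k * u0 i + K i / (gam * al) * (1 - rho ^ k))"
      using main by (intro sum_mono) blast
    also have "\<dots> = rho ^ k * lyapunov W G c al xs x0 h0 + (\<Sum>i\<in>UNIV. K i / (gam * al)) * (1 - rho ^ k)"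
      by (simp only: sum.distrib sum_distrib_left [symmetric] sum_distrib_right [symmetric] lyapunov_eq_sum u0_def)
    also have "\<dots> \<le> rho ^ k * lyapunov W G c al xs x0 h0 + ?Gam * (1 - rho ^ k)"
      using rho by (intro add_left_mono mult_right_mono sumK) (simp add: power_le_one)
    finally show ?thesis .
  qed
  have intS: "integrable P (\<lambda>w. sq_error W xs (\<lambda>i. x i k w))" for k
  proof -
    have "(\<lambda>w. x i k w - xs) \<in> borel_measurable P" for i
      using measurable_from_subalg [OF F conjunct1 [OF main [of i k]]] by measurable
    moreover have "integrable P (\<lambda>w. (norm (x i k w - xs))\<^sup>2)" for i
      using main [of i k] by (elim conjE)
    ultimately show ?thesis
      unfolding lyapunov_eq_sum wnorm2_def by (intro Bochner_Integration.integrable_sum integrable_wip)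
  qed
  have "(\<integral>w. sq_error W xs (\<lambda>i. x i k w) \<partial>P)
      \<le> rho ^ k * lyapunov W G c al xs x0 h0 + ?Gam * (1 - rho ^ k)" for k
  proof (rule order_trans [OF integral_mono [OF intS intL] bound])
    show "sq_error W xs (\<lambda>i. x i k w) \<le> lyapunov W G c al xs (\<lambda>i. x i k w) (\<lambda>i. h i k w)" for w
      unfolding lyapunov_eq_sum using c0 al0 pos_def_imp_wnorm2_nonneg [OF W] by (intro sum_mono) simp
  qed
  then have "limsup (\<lambda>k. ereal (\<integral>w. sq_error W xs (\<lambda>i. x i k w) \<partial>P))
      \<le> limsup (\<lambda>k. ereal (rho ^ k * lyapunov W G c al xs x0 h0 + ?Gam * (1 - rho ^ k)))"
    by (intro Limsup_mono always_eventually) simp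
  also have "\<dots> = ereal ?Gam"
  proof (rule lim_imp_Limsup)
    have "(\<lambda>k. rho ^ k * lyapunov W G c al xs x0 h0 + ?Gam * (1 - rho ^ k))
        \<longlonglongrightarrow> 0 * lyapunov W G c al xs x0 h0 + ?Gam * (1 - 0)"
      using rho by (intro tendsto_intros) simp_all
    then show "(\<lambda>k. ereal (rho ^ k * lyapunov W G c al xs x0 h0 + ?Gam * (1 - rho ^ k))) \<longlonglongrightarrow> ereal ?Gam"
      by simp
  qed simp
  finally show ?thesis using intL intS bound unfolding rho_def by blast
qed

end
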